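(* Let $\mathcal P=(\mathcal{PV},\mathcal L,\mathcal{GT},\ell_0)$ be a PIP, let $(\mathcal{RT}_{\mathbb E}^\sqcap,\mathcal{S}_{\mathbb E}^\sqcap)$ be an expected bound pair, let $\mathcal{RT}^\sqcap$ be a (non-probabilistic) runtime bound, and let $r$ be a PLRF for some $\mathcal{GT}_>\subseteq\mathcal{GT}_{ni}\subseteq\mathcal{GT}$. Let $\mathcal{EL}_{\mathrm c,\mathcal{GT}_{ni}}=\{\ell\in\mathcal{EL}_{\mathcal{GT}_{ni}}\mid r(\ell)\in\mathbb R\}$ and $\mathcal{EL}_{\mathrm{nc},\mathcal{GT}_{ni}}=\{\ell\in\mathcal{EL}_{\mathcal{GT}_{ni}}\mid r(\ell)\notin\mathbb R\}$ (constant resp. non-constant entry locations). Then $\mathcal{RT}_{\mathbb E}^{\sqcap\prime}:\mathcal{GT}\to\mathcal B$ is an expected runtime bound, where $\mathcal{RT}_{\mathbb E}^{\sqcap\prime}(g)=\mathcal{RT}_{\mathbb E}^\sqcap(g)$ if $g\notin\mathcal{GT}_>$, and for $g\in\mathcal{GT}_>$ $$\mathcal{RT}_{\mathbb E}^{\sqcap\prime}(g)=\sum_{\substack{\ell\in\mathcal{EL}_{\mathrm{nc},\mathcal{GT}_{ni}}\\ h\in\mathcal{ET}_{\mathcal{GT}_{ni}}(\ell)}}\Big(\sum_{t=(\_,\_,\_,\_,\ell)\in h}\mathcal{RT}^\sqcap(t)\Big)\cdot\Big(\mathcal{S}_{\mathbb E}^\sqcap(h,\ell,\cdot)\big(\lceil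 r(\ell)\rceil\big)\Big)+\sum_{\substack{\ell\in\mathcal{EL}_{\mathrm c,\mathcal{GT}_{ni}}\\ h\in\mathcal{ET}_{\mathcal{GT}_{ni}}(\ell)}}\mathcal{RT}_{\mathbb E}^\sqcap(h)\cdot\lceil r(\ell)\rceil.$$
   Context: States: $\mathcal V$ finite set of variables, states $s:\mathcal V\to\mathbb Z$, $\Sigma$ the set of states, $|s|(x)=|s(x)|$. Constraints: finite conjunctions of $e_1\le e_2$, $e_i\in\mathbb Z[\mathcal V]$. $\mathrm{Dist}(\mathbb Z)$: distributions on $\mathbb Z$ with well-defined finite expectation $\mathbb E(pr)$; distribution functions $d:\Sigma\to\mathrm{Dist}(\mathbb Z)$ form $\mathcal D$. A PIP $(\mathcal{PV},\mathcal L,\mathcal{GT},\ell_0)$: finite $\mathcal{PV}\subseteq\mathcal V$ (program variables; others temporary), finite nonempty location set $\mathcal L$, initial location $\ell_0$ (target of no transition), finite nonempty set $\mathcal{GT}$ of general transitions; each general transition $g$ is a finite nonempty set of transitions $t=(\ell,p,\tau,\eta,\ell')$ (start location, probability $p\ge0$, guard constraint $\tau$, update $\eta:\mathcal{PV}\to\mathbb Z[\mathcal V]\cup\mathcal D$, target location) with common start location $\ell_g$ and guard $\tau_g$ and probabilities summing to $1$. $\mathcal T=\bigcup\mathcal{GT}$. Semantics: configurations $(\ell,t,s)\in(\mathcal L\uplus\{\ell_\bot\})\times(\mathcal T\uplus\{t_{in},t_\bot\})\times\Sigma$; runs are infinite sequences of them. A scheduler $\mathfrak S$ maps $(\ell,t,s)$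 to $(g,s')$ with $s'|_{\mathcal{PV}}=s|_{\mathcal{PV}}$, $\ell_g=\ell$, $s'(\tau_g)$ true, or to $(g_\bot,s)$, $g_\bot=\{t_\bot\}$, if $\ell=\ell_\bot$, $t=t_\bot$ or no such choice exists. For $\mathfrak S$ and initial state $s_0$, runs start in $(\ell_0,t_{in},s_0)$; from $c'$ with $\mathfrak S(c')=(g,\tilde s)$, $g\neq g_\bot$, the next configuration is $(\ell,t,s)$ with $t=(\ell_g,p,\tau,\eta,\ell)\in g$ with probability $p$ times the probability that $s$ arises from $\tilde s$ (temporary variables unchanged; $x$ with polynomial $\eta(x)$ becomes $\tilde s(\eta(x))$; $x$ with $\eta(x)=d$ becomes $\tilde s(x)+v$, $v$ sampled from $d(\tilde s)$); if $g=g_\bot$ the next configuration is $(\ell_\bot,t_\bot,s)$. This defines probabilities of finite paths, a probability measure on runs and expectation $\mathbb E^{\mathfrak S}_{s_0}$; a finite path is admissible if it has positive probability. Bounds: $\mathcal B$ is the smallest set containing $\mathcal{PV}\cup\overline{\mathbb R}_{\ge0}$ closed under $+$, $\cdot$, $b\mapsto v^b$ ($v\ge1$). Runtime bound $\mathcal{RT}^\sqcap:\mathcal T\to\mathcal B$: $|s_0|(\mathcal{RT}^\sqcap(t))\ge$ the supremum over admissible finite paths (any $\mathfrak S,s_0$) of the number of occurrences of $t$. $\mathcal R(g)(\text{run})$ = number of positions whose transition is in $g$. $\mathcal{GRV}=\{(g,\ell,x)\mid g\in\mathcal{GT},x\in\mathcal{PV},\ \ell$ target of some $t\in g\}$; $\mathcal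 S(g,\ell,x)((\ell_i,t_i,s_i)_i)=\sup\{|s_i(x)|\mid\ell_i=\ell,t_i\in g\}$. Expected runtime bound $\mathcal{RT}_{\mathbb E}^\sqcap:\mathcal{GT}\to\mathcal B$: $|s_0|(\mathcal{RT}_{\mathbb E}^\sqcap(g))\ge\mathbb E^{\mathfrak S}_{s_0}(\mathcal R(g))$ for all $g,\mathfrak S,s_0$; expected size bound $\mathcal{S}_{\mathbb E}^\sqcap:\mathcal{GRV}\to\mathcal B$: $|s_0|(\mathcal{S}_{\mathbb E}^\sqcap(\alpha))\ge\mathbb E^{\mathfrak S}_{s_0}(\mathcal S(\alpha))$; together an expected bound pair. PLRF: for $r:\mathcal L\to\mathbb R[\mathcal{PV}]$, $\exp_{r,g,s}=\sum_{(\ell,p,\tau,\eta,\ell')\in g}p\cdot s_\eta(r(\ell'))$, where $s_\eta(r(\ell'))$ evaluates $r(\ell')$ with each $x\in\mathcal{PV}$ replaced by $s_\eta(x)$, $s_\eta(x)=s(\eta(x))$ for polynomial $\eta(x)$ and $s_\eta(x)=s(x)+\mathbb E(\eta(x)(s))$ if $\eta(x)\in\mathcal D$. $r$ is a PLRF for $\mathcal{GT}_>\subseteq\mathcal{GT}_{ni}\subseteq\mathcal{GT}$ if each $r(\ell)$ has degree at most 1 and for all finite paths $\cdots c'\,c$, $c=(\ell,t,s)$, admissible for some scheduler and initial state: (Boundedness a) for $g\in\mathcal{GT}_{ni}\setminus\mathcal{GT}_>$ there is $\bowtie_{g,c'}\in\{<,\ge\}$ with $t\in g\Rightarrow s(r(\ell))\bowtie_{g,c'}0$;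 (Boundedness b) for $g\in\mathcal{GT}_>$, $t\in g\Rightarrow s(r(\ell))\ge0$; (Non-Increase) for $g\in\mathcal{GT}_{ni}$, $\ell=\ell_g$ and $s(\tau_g)$ true imply $s(r(\ell))\ge\exp_{r,g,s}$; (Decrease) for $g\in\mathcal{GT}_>$, $\ell=\ell_g$ and $s(\tau_g)$ true imply $s(r(\ell))-1\ge\exp_{r,g,s}$. Entry transitions $\mathcal{ET}_{\mathcal{GT}_{ni}}(\ell)=\{g\in\mathcal{GT}\setminus\mathcal{GT}_{ni}\mid\exists t\in g$ with target $\ell\}$; entry locations $\mathcal{EL}_{\mathcal{GT}_{ni}}=\{\ell\mid\mathcal{ET}_{\mathcal{GT}_{ni}}(\ell)\ne\emptyset$ and $\ell$ is the start location of a transition in $\bigcup\mathcal{GT}_{ni}\}$. $\lceil e\rceil$ replaces every coefficient of $e$ by its absolute value; $\mathcal{S}_{\mathbb E}^\sqcap(h,\ell,\cdot)(b)$ substitutes $\mathcal{S}_{\mathbb E}^\sqcap(h,\ell,x)$ for each $x\in\mathcal{PV}$ in $b$.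
   Formalization: Added, as the claim fails otherwise: no transition of GT_ni starts in l_0; no g in GT_> shares a transition with an h in GT_ni \ GT_>; Non-Increase and Decrease hold for every change of temporary variables a scheduler may make before executing g. *)

theory Defs
  imports "HOL-Probability.Probability" "HOL-Library.Poly_Mapping"
begin

section \<open>Polynomials, states, constraints\<close>

text \<open>The ring of polynomials over \<open>'a\<close> in the variables \<open>'v\<close>: finitely supported maps from
  monomials (finitely supported exponent maps) to coefficients.\<close>

type_synonym ('v, 'a) mpoly = "('v \<Rightarrow>\<^sub>0 nat) \<Rightarrow>\<^sub>0 'a"

definition mono_eval :: "('v \<Rightarrow> 'a::comm_semiring_1) \<Rightarrow> ('v \<Rightarrow>\<^sub>0 nat) \<Rightarrow> 'a" where
  "mono_eval \<beta> m = (\<Prod>x\<in>Poly_Mapping.keys m. \<beta> x ^ Poly_Mapping.lookup m x)"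

definition peval :: "('v \<Rightarrow> 'a::comm_semiring_1) \<Rightarrow> ('v, 'a) mpoly \<Rightarrow> 'a" where
  "peval \<beta> p = (\<Sum>m\<in>Poly_Mapping.keys p. Poly_Mapping.lookup p m * mono_eval \<beta> m)"

definition pvarset :: "('v, 'a::zero) mpoly \<Rightarrow> 'v set" where
  "pvarset p = (\<Union>m\<in>Poly_Mapping.keys p. Poly_Mapping.keys m)"

definition mono_degree :: "('v \<Rightarrow>\<^sub>0 nat) \<Rightarrow> nat" where
  "mono_degree m = (\<Sum>x\<in>Poly_Mapping.keys m. Poly_Mapping.lookup m x)"

definition deg_le :: "('v, 'a::zero) mpoly \<Rightarrow> nat \<Rightarrow> bool" where
  "deg_le p n \<longleftrightarrow> (\<forall>m\<in>Poly_Mapping.keys p. mono_degree m \<le> n)"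

definition is_const_poly :: "('v, 'a::zero) mpoly \<Rightarrow> bool" where
  "is_const_poly p \<longleftrightarrow> (\<exists>a. p = Poly_Mapping.single 0 a)"

text \<open>The set of all variables is the finite type \<open>'v\<close>.\<close>

type_synonym 'v state = "'v \<Rightarrow> int"

type_synonym 'v constr = "(('v, int) mpoly \<times> ('v, int) mpoly) list"

definition sat :: "'v state \<Rightarrow> 'v constr \<Rightarrow> bool" where
  "sat s \<tau> \<longleftrightarrow> (\<forall>(e1, e2)\<in>set \<tau>. peval s e1 \<le> peval s e2)"

definition reval :: "'v state \<Rightarrow> ('v, real) mpoly \<Rightarrow> real" where
  "reval s p = peval (\<lambda>x. real_of_int (s x)) p"


section \<open>Probabilistic integer programs\<close>

type_synonym 'v distfun = "'v state \<Rightarrow> int pmf"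

definition distfuns :: "'v distfun set" where
  "distfuns = {d. \<forall>s. integrable (measure_pmf (d s)) real_of_int}"

datatype 'v upd = Poly "('v, int) mpoly" | Sample "'v distfun"

text \<open>An update is a partial map; its domain is the set of program variables (see \<open>is_pip\<close>).\<close>

datatype ('l, 'v) trans =
  Trans (src: 'l) (tprob: real) (guard: "'v constr") (eta: "'v \<Rightarrow> 'v upd option") (tgt: 'l)

type_synonym ('l, 'v) gtrans = "('l, 'v) trans set"

record ('l, 'v) pip =
  PV :: "'v set"
  locs :: "'l set"
  GT :: "('l, 'v) gtrans set"
  init_loc :: 'l

definition gsrc :: "('l, 'v) gtrans \<Rightarrow> 'l" where
  "gsrc g = the_elem (src ` g)"

definition gguard :: "('l, 'v) gtrans \<Rightarrow> 'v constr" where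
  "gguard g = the_elem (guard ` g)"

definition transitions :: "('l, 'v) pip \<Rightarrow> ('l, 'v) trans set" where
  "transitions P = \<Union> (GT P)"

definition is_trans :: "('l, 'v) pip \<Rightarrow> ('l, 'v) trans \<Rightarrow> bool" where
  "is_trans P t \<longleftrightarrow> src t \<in> locs P \<and> tgt t \<in> locs P \<and> 0 \<le> tprob t \<and> dom (eta t) = PV P \<and>
     (\<forall>x d. eta t x = Some (Sample d) \<longrightarrow> d \<in> distfuns)"

definition is_gtrans :: "('l, 'v) pip \<Rightarrow> ('l, 'v) gtrans \<Rightarrow> bool" where
  "is_gtrans P g \<longleftrightarrow> finite g \<and> g \<noteq> {} \<and> (\<forall>t\<in>g. is_trans P t) \<and>
     (\<forall>t\<in>g. \<forall>t'\<in>g. src t = src t' \<and> guard t = guard t') \<and> (\<Sum>t\<in>g. tprob t) = 1"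

definition is_pip :: "('l, 'v::finite) pip \<Rightarrow> bool" where
  "is_pip P \<longleftrightarrow> finite (locs P) \<and> locs P \<noteq> {} \<and> init_loc P \<in> locs P \<and>
     finite (GT P) \<and> GT P \<noteq> {} \<and> (\<forall>g\<in>GT P. is_gtrans P g) \<and>
     (\<forall>t\<in>transitions P. tgt t \<noteq> init_loc P)"


section \<open>Semantics\<close>

datatype 't label = T_in | T_bot | T_ex 't

text \<open>Location \<open>None\<close> is the extra location reached after termination; general transition \<open>None\<close>
  is the extra one leading to it.\<close>

type_synonym ('l, 'v) conf = "'l option \<times> ('l, 'v) trans label \<times> 'v state"

type_synonym ('l, 'v) sched = "('l, 'v) conf \<Rightarrow> ('l, 'v) gtrans option \<times> 'v state"

definition confs :: "('l, 'v) pip \<Rightarrow> ('l, 'v) conf set" where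
  "confs P = (insert None (Some ` locs P)) \<times> ({T_in, T_bot} \<union> T_ex ` transitions P) \<times> UNIV"

definition agree_on :: "'v set \<Rightarrow> 'v state \<Rightarrow> 'v state \<Rightarrow> bool" where
  "agree_on X s s' \<longleftrightarrow> (\<forall>x\<in>X. s' x = s x)"

definition choices :: "('l, 'v) pip \<Rightarrow> 'l option \<Rightarrow> 'v state \<Rightarrow> (('l, 'v) gtrans \<times> 'v state) set" where
  "choices P l s = {(g, s'). g \<in> GT P \<and> agree_on (PV P) s s' \<and> l = Some (gsrc g) \<and> sat s' (gguard g)}"

definition is_scheduler :: "('l, 'v) pip \<Rightarrow> ('l, 'v) sched \<Rightarrow> bool" where
  "is_scheduler P \<SS> \<longleftrightarrow> (\<forall>(l, t, s)\<in>confs P.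
     if l = None \<or> t = T_bot \<or> choices P l s = {} then \<SS> (l, t, s) = (None, s)
     else \<exists>(g, s')\<in>choices P l s. \<SS> (l, t, s) = (Some g, s'))"

definition gtrans_pmf :: "('l, 'v) gtrans \<Rightarrow> ('l, 'v) trans pmf" where
  "gtrans_pmf g = embed_pmf (\<lambda>t. if t \<in> g then tprob t else 0)"

definition var_upd_pmf :: "('v \<Rightarrow> 'v upd option) \<Rightarrow> 'v state \<Rightarrow> 'v \<Rightarrow> int pmf" where
  "var_upd_pmf \<eta> s x = (case \<eta> x of
       None \<Rightarrow> return_pmf (s x)
     | Some (Poly p) \<Rightarrow> return_pmf (peval s p)
     | Some (Sample d) \<Rightarrow> map_pmf (\<lambda>v. s x + v) (d s))"

text \<open>The variables are sampled independently.\<close>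

definition state_upd_pmf :: "('v::finite \<Rightarrow> 'v upd option) \<Rightarrow> 'v state \<Rightarrow> 'v state pmf" where
  "state_upd_pmf \<eta> s = Pi_pmf UNIV undefined (var_upd_pmf \<eta> s)"

definition step_pmf :: "('l, 'v::finite) sched \<Rightarrow> ('l, 'v) conf \<Rightarrow> ('l, 'v) conf pmf" where
  "step_pmf \<SS> c = (case \<SS> c of
       (None, s) \<Rightarrow> return_pmf (None, T_bot, s)
     | (Some g, s) \<Rightarrow> bind_pmf (gtrans_pmf g)
          (\<lambda>t. map_pmf (\<lambda>s'. (Some (tgt t), T_ex t, s')) (state_upd_pmf (eta t) s)))"

definition init_conf :: "('l, 'v) pip \<Rightarrow> 'v state \<Rightarrow> ('l, 'v) conf" where
  "init_conf P s0 = (Some (init_loc P), T_in, s0)"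

text \<open>Finite paths are nonempty lists of configurations.\<close>

definition path_prob :: "('l, 'v::finite) pip \<Rightarrow> ('l, 'v) sched \<Rightarrow> 'v state \<Rightarrow> ('l, 'v) conf list \<Rightarrow> real" where
  "path_prob P \<SS> s0 cs = (if cs \<noteq> [] \<and> hd cs = init_conf P s0
     then \<Prod>i<length cs - 1. pmf (step_pmf \<SS> (cs ! i)) (cs ! Suc i) else 0)"

definition admissible :: "('l, 'v::finite) pip \<Rightarrow> ('l, 'v) sched \<Rightarrow> 'v state \<Rightarrow> ('l, 'v) conf list \<Rightarrow> bool" where
  "admissible P \<SS> s0 cs \<longleftrightarrow> path_prob P \<SS> s0 cs > 0"

text \<open>The measure on runs is the Ionescu-Tulcea measure of the Markov chain of configurations;
  lemma \<open>run_measure_cylinder\<close> relates it to \<open>path_prob\<close>.\<close>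

primrec run_kernel :: "('l, 'v::finite) pip \<Rightarrow> ('l, 'v) sched \<Rightarrow> 'v state \<Rightarrow> nat \<Rightarrow>
    (nat \<Rightarrow> ('l, 'v) conf) \<Rightarrow> ('l, 'v) conf measure" where
  "run_kernel P \<SS> s0 0 = (\<lambda>\<omega>. measure_pmf (return_pmf (init_conf P s0)))"
| "run_kernel P \<SS> s0 (Suc n) = (\<lambda>\<omega>. measure_pmf (step_pmf \<SS> (\<omega> n)))"

global_interpretation runs: Ionescu_Tulcea "run_kernel P \<SS> s0" "\<lambda>_. count_space UNIV"
  for P and \<SS> s0
proof (rule Ionescu_Tulcea.intro, goal_cases)
  case (1 i)
  show "run_kernel P \<SS> s0 i \<in> measurable (Pi\<^sub>M {0..<i} (\<lambda>_. count_space UNIV))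
          (subprob_algebra (count_space UNIV))"
  proof (cases i)
    case 0
    have "(\<lambda>\<omega>. measure_pmf (return_pmf (init_conf P s0))) \<in>
        measurable (Pi\<^sub>M {0..<0} (\<lambda>_. count_space UNIV)) (subprob_algebra (count_space UNIV))"
      by (rule measurable_const) (rule measure_pmf_in_subprob_algebra)
    then show ?thesis
      unfolding 0 run_kernel.simps .
  next
    case (Suc n)
    have "(\<lambda>\<omega>. \<omega> n) \<in> measurable (Pi\<^sub>M {0..<Suc n} (\<lambda>_. count_space UNIV)) (count_space UNIV)"
      by (rule measurable_component_singleton) simp
    moreover have "(\<lambda>c. measure_pmf (step_pmf \<SS> c)) \<in> measurable (count_space UNIV) (subprob_algebra (count_space UNIV))"
      by (auto simp: measure_pmf_in_subprob_algebra)
    ultimately show ?thesis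
      unfolding Suc run_kernel.simps by (rule measurable_compose)
  qed
next
  case (2 i \<omega>)
  show "prob_space (run_kernel P \<SS> s0 i \<omega>)"
    by (cases i) (simp_all add: measure_pmf.prob_space_axioms)
qed

definition run_measure :: "('l, 'v::finite) pip \<Rightarrow> ('l, 'v) sched \<Rightarrow> 'v state \<Rightarrow>
    (nat \<Rightarrow> ('l, 'v) conf) measure" where
  "run_measure P \<SS> s0 = runs.PF.lim P \<SS> s0"

definition run_expectation :: "('l, 'v::finite) pip \<Rightarrow> ('l, 'v) sched \<Rightarrow> 'v state \<Rightarrow>
    ((nat \<Rightarrow> ('l, 'v) conf) \<Rightarrow> ennreal) \<Rightarrow> ennreal" where
  "run_expectation P \<SS> s0 X = (\<integral>\<^sup>+ \<omega>. X \<omega> \<partial>run_measure P \<SS> s0)"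


section \<open>Bounds\<close>

text \<open>A bound is identified with its value as a function of the absolute values of the variables.
  The type \<open>ennreal\<close> uses the convention \<open>0 * \<infinity> = 0\<close>.\<close>

type_synonym 'v bound = "('v \<Rightarrow> nat) \<Rightarrow> ennreal"

definition abs_state :: "'v state \<Rightarrow> 'v \<Rightarrow> nat" where
  "abs_state s x = nat \<bar>s x\<bar>"

definition bexp :: "real \<Rightarrow> ennreal \<Rightarrow> ennreal" where
  "bexp v a = (if a < \<infinity> then ennreal (v powr enn2real a) else if v = 1 then 1 else \<infinity>)"

definition bvar :: "'v \<Rightarrow> 'v bound" where
  "bvar x = (\<lambda>\<sigma>. of_nat (\<sigma> x))"

inductive_set bounds :: "'v set \<Rightarrow> 'v bound set" for X where
  bounds_var: "x \<in> X \<Longrightarrow> bvar x \<in> bounds X"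
| bounds_const: "(\<lambda>_. a) \<in> bounds X"
| bounds_add: "b1 \<in> bounds X \<Longrightarrow> b2 \<in> bounds X \<Longrightarrow> (\<lambda>\<sigma>. b1 \<sigma> + b2 \<sigma>) \<in> bounds X"
| bounds_mult: "b1 \<in> bounds X \<Longrightarrow> b2 \<in> bounds X \<Longrightarrow> (\<lambda>\<sigma>. b1 \<sigma> * b2 \<sigma>) \<in> bounds X"
| bounds_exp: "b \<in> bounds X \<Longrightarrow> v \<ge> 1 \<Longrightarrow> (\<lambda>\<sigma>. bexp v (b \<sigma>)) \<in> bounds X"

text \<open>Value of a polynomial, all of whose coefficients are replaced by their absolute values, after
  substituting the bound \<open>\<beta> x\<close> for each variable \<open>x\<close>.\<close>

definition abs_poly_subst :: "('v \<Rightarrow> 'v bound) \<Rightarrow> ('v, real) mpoly \<Rightarrow> 'v bound" where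
  "abs_poly_subst \<beta> p = (\<lambda>\<sigma>. \<Sum>m\<in>Poly_Mapping.keys p.
     ennreal \<bar>Poly_Mapping.lookup p m\<bar> * mono_eval (\<lambda>x. \<beta> x \<sigma>) m)"

definition trans_count :: "('l, 'v) trans \<Rightarrow> ('l, 'v) conf list \<Rightarrow> nat" where
  "trans_count t cs = card {i. i < length cs \<and> fst (snd (cs ! i)) = T_ex t}"

definition runtime_bound :: "('l, 'v::finite) pip \<Rightarrow> (('l, 'v) trans \<Rightarrow> 'v bound) \<Rightarrow> bool" where
  "runtime_bound P RT \<longleftrightarrow> (\<forall>t\<in>transitions P. RT t \<in> bounds (PV P) \<and>
     (\<forall>s0. RT t (abs_state s0) \<ge>
       (SUP cs\<in>{cs. \<exists>\<SS>. is_scheduler P \<SS> \<and> admissible P \<SS> s0 cs}. of_nat (trans_count t cs))))"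

definition gtrans_count :: "('l, 'v) gtrans \<Rightarrow> (nat \<Rightarrow> ('l, 'v) conf) \<Rightarrow> ennreal" where
  "gtrans_count g \<omega> = emeasure (count_space UNIV) {i. fst (snd (\<omega> i)) \<in> T_ex ` g}"

definition grv :: "('l, 'v) pip \<Rightarrow> (('l, 'v) gtrans \<times> 'l \<times> 'v) set" where
  "grv P = {(g, l, x). g \<in> GT P \<and> x \<in> PV P \<and> l \<in> tgt ` g}"

definition gsize :: "('l, 'v) gtrans \<Rightarrow> 'l \<Rightarrow> 'v \<Rightarrow> (nat \<Rightarrow> ('l, 'v) conf) \<Rightarrow> ennreal" where
  "gsize g l x \<omega> = (SUP i\<in>{i. fst (\<omega> i) = Some l \<and> fst (snd (\<omega> i)) \<in> T_ex ` g}.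
     of_nat (abs_state (snd (snd (\<omega> i))) x))"

definition expected_runtime_bound :: "('l, 'v::finite) pip \<Rightarrow> (('l, 'v) gtrans \<Rightarrow> 'v bound) \<Rightarrow> bool" where
  "expected_runtime_bound P RTE \<longleftrightarrow> (\<forall>g\<in>GT P. RTE g \<in> bounds (PV P) \<and>
     (\<forall>\<SS> s0. is_scheduler P \<SS> \<longrightarrow>
       RTE g (abs_state s0) \<ge> run_expectation P \<SS> s0 (gtrans_count g)))"

definition expected_size_bound :: "('l, 'v::finite) pip \<Rightarrow>
    (('l, 'v) gtrans \<Rightarrow> 'l \<Rightarrow> 'v \<Rightarrow> 'v bound) \<Rightarrow> bool" where
  "expected_size_bound P SE \<longleftrightarrow> (\<forall>(g, l, x)\<in>grv P. SE g l x \<in> bounds (PV P) \<and>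
     (\<forall>\<SS> s0. is_scheduler P \<SS> \<longrightarrow>
       SE g l x (abs_state s0) \<ge> run_expectation P \<SS> s0 (gsize g l x)))"

definition expected_bound_pair :: "('l, 'v::finite) pip \<Rightarrow> (('l, 'v) gtrans \<Rightarrow> 'v bound) \<Rightarrow>
    (('l, 'v) gtrans \<Rightarrow> 'l \<Rightarrow> 'v \<Rightarrow> 'v bound) \<Rightarrow> bool" where
  "expected_bound_pair P RTE SE \<longleftrightarrow> expected_runtime_bound P RTE \<and> expected_size_bound P SE"


section \<open>Probabilistic linear ranking functions\<close>

definition upd_expectation :: "'v state \<Rightarrow> ('v \<Rightarrow> 'v upd option) \<Rightarrow> 'v \<Rightarrow> real" where
  "upd_expectation s \<eta> x = (case \<eta> x of
       None \<Rightarrow> real_of_int (s x)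
     | Some (Poly p) \<Rightarrow> real_of_int (peval s p)
     | Some (Sample d) \<Rightarrow> real_of_int (s x) + measure_pmf.expectation (d s) real_of_int)"

definition exp_rank :: "('l \<Rightarrow> ('v, real) mpoly) \<Rightarrow> ('l, 'v) gtrans \<Rightarrow> 'v state \<Rightarrow> real" where
  "exp_rank r g s = (\<Sum>t\<in>g. tprob t * peval (upd_expectation s (eta t)) (r (tgt t)))"

definition adm_step :: "('l, 'v::finite) pip \<Rightarrow> ('l, 'v) conf \<Rightarrow> ('l, 'v) conf \<Rightarrow> bool" where
  "adm_step P c' c \<longleftrightarrow> (\<exists>\<SS> s0 cs. is_scheduler P \<SS> \<and> admissible P \<SS> s0 (cs @ [c', c]))"

text \<open>In the last two conditions, the guard and the expected value are evaluated in any state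
  \<open>s'\<close> from which a scheduler may execute \<open>g\<close> in \<open>(l, t, s)\<close>: schedulers may change the temporary
  variables of \<open>s\<close> before \<open>g\<close> is executed. The choice \<open>s' = s\<close> is included, and it is the only one
  if all variables are program variables.\<close>

definition is_plrf :: "('l, 'v::finite) pip \<Rightarrow> ('l \<Rightarrow> ('v, real) mpoly) \<Rightarrow>
    ('l, 'v) gtrans set \<Rightarrow> ('l, 'v) gtrans set \<Rightarrow> bool" where
  "is_plrf P r GTgt GTni \<longleftrightarrow>
     GTgt \<subseteq> GTni \<and> GTni \<subseteq> GT P \<and>
     (\<forall>l\<in>locs P. pvarset (r l) \<subseteq> PV P \<and> deg_le (r l) 1) \<and>
     (\<forall>g\<in>GTni - GTgt. \<forall>c'.
        (\<forall>l t s. adm_step P c' (Some l, T_ex t, s) \<and> t \<in> g \<longrightarrow> reval s (r l) < 0) \<or>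
        (\<forall>l t s. adm_step P c' (Some l, T_ex t, s) \<and> t \<in> g \<longrightarrow> reval s (r l) \<ge> 0)) \<and>
     (\<forall>g\<in>GTgt. \<forall>c' l t s.
        adm_step P c' (Some l, T_ex t, s) \<and> t \<in> g \<longrightarrow> reval s (r l) \<ge> 0) \<and>
     (\<forall>g\<in>GTni. \<forall>c' l t s s'.
        adm_step P c' (Some l, t, s) \<and> agree_on (PV P) s s' \<and> l = gsrc g \<and> sat s' (gguard g) \<longrightarrow>
        reval s' (r l) \<ge> exp_rank r g s') \<and>
     (\<forall>g\<in>GTgt. \<forall>c' l t s s'.
        adm_step P c' (Some l, t, s) \<and> agree_on (PV P) s s' \<and> l = gsrc g \<and> sat s' (gguard g) \<longrightarrow>
        reval s' (r l) - 1 \<ge> exp_rank r g s')"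

definition entry_trans :: "('l, 'v) pip \<Rightarrow> ('l, 'v) gtrans set \<Rightarrow> 'l \<Rightarrow> ('l, 'v) gtrans set" where
  "entry_trans P GTni l = {g \<in> GT P - GTni. \<exists>t\<in>g. tgt t = l}"

definition entry_locs :: "('l, 'v) pip \<Rightarrow> ('l, 'v) gtrans set \<Rightarrow> 'l set" where
  "entry_locs P GTni = {l. entry_trans P GTni l \<noteq> {} \<and> (\<exists>t\<in>\<Union>GTni. src t = l)}"

definition const_entry_locs :: "('l, 'v) pip \<Rightarrow> ('l \<Rightarrow> ('v, real) mpoly) \<Rightarrow> ('l, 'v) gtrans set \<Rightarrow> 'l set" where
  "const_entry_locs P r GTni = {l \<in> entry_locs P GTni. is_const_poly (r l)}"

definition nonconst_entry_locs :: "('l, 'v) pip \<Rightarrow> ('l \<Rightarrow> ('v, real) mpoly) \<Rightarrow> ('l, 'v) gtrans set \<Rightarrow> 'l set" where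
  "nonconst_entry_locs P r GTni = {l \<in> entry_locs P GTni. \<not> is_const_poly (r l)}"

definition refined_runtime_bound :: "('l, 'v) pip \<Rightarrow> (('l, 'v) gtrans \<Rightarrow> 'v bound) \<Rightarrow>
    (('l, 'v) gtrans \<Rightarrow> 'l \<Rightarrow> 'v \<Rightarrow> 'v bound) \<Rightarrow> (('l, 'v) trans \<Rightarrow> 'v bound) \<Rightarrow>
    ('l \<Rightarrow> ('v, real) mpoly) \<Rightarrow> ('l, 'v) gtrans set \<Rightarrow> ('l, 'v) gtrans set \<Rightarrow>
    ('l, 'v) gtrans \<Rightarrow> 'v bound" where
  "refined_runtime_bound P RTE SE RT r GTgt GTni g =
     (if g \<notin> GTgt then RTE g
      else (\<lambda>\<sigma>.
        (\<Sum>l\<in>nonconst_entry_locs P r GTni. \<Sum>h\<in>entry_trans P GTni l.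
           (\<Sum>t\<in>{t \<in> h. tgt t = l}. RT t \<sigma>) * abs_poly_subst (SE h l) (r l) \<sigma>) +
        (\<Sum>l\<in>const_entry_locs P r GTni. \<Sum>h\<in>entry_trans P GTni l.
           RTE h \<sigma> * abs_poly_subst bvar (r l) \<sigma>)))"


section \<open>Adequacy of the semantics\<close>

lemma pmf_gtrans_pmf:
  assumes "is_gtrans P g"
  shows "pmf (gtrans_pmf g) t = (if t \<in> g then tprob t else 0)"
  unfolding gtrans_pmf_def
proof (rule pmf_embed_pmf)
  show "\<And>t. 0 \<le> (if t \<in> g then tprob t else 0)"
    using assms by (auto simp: is_gtrans_def is_trans_def)
  have fin: "finite g" and nn: "\<And>t. t \<in> g \<Longrightarrow> 0 \<le> tprob t" and one: "(\<Sum>t\<in>g. tprob t) = 1"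
    using assms by (auto simp: is_gtrans_def is_trans_def)
  have "(\<integral>\<^sup>+ t. ennreal (if t \<in> g then tprob t else 0) \<partial>count_space UNIV) =
        (\<integral>\<^sup>+ t. ennreal (tprob t) * indicator g t \<partial>count_space UNIV)"
    by (intro nn_integral_cong) (auto split: split_indicator)
  also have "\<dots> = (\<integral>\<^sup>+ t. ennreal (tprob t) \<partial>count_space g)"
    by (simp add: nn_integral_count_space_indicator)
  also have "\<dots> = (\<Sum>t\<in>g. ennreal (tprob t))"
    using fin by (rule nn_integral_count_space_finite)
  also have "\<dots> = ennreal (\<Sum>t\<in>g. tprob t)"
    using nn by (rule sum_ennreal)
  finally show "(\<integral>\<^sup>+ t. ennreal (if t \<in> g then tprob t else 0) \<partial>count_space UNIV) = 1"
    using one by simp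
qed

lemma pmf_state_upd_pmf: "pmf (state_upd_pmf \<eta> s) s' = (\<Prod>x\<in>UNIV. pmf (var_upd_pmf \<eta> s x) (s' x))"
  unfolding state_upd_pmf_def by (subst pmf_Pi) auto

lemma emeasure_C_cylinder:
  "emeasure (runs.C P \<SS> s0 0 n (\<lambda>_. undefined)) (PiE {0..<n} (\<lambda>i. {cs ! i})) =
     (\<Prod>i<n. emeasure (run_kernel P \<SS> s0 i (\<lambda>j. cs ! j)) {cs ! i})"
proof (induction n)
  case 0
  have "(\<lambda>_. undefined) \<in> PiE {0..<0} (\<lambda>i. {cs ! i})"
    by simp
  moreover have "PiE {0..<0} (\<lambda>i. {cs ! i}) \<in> sets (PiM {0..<0} (\<lambda>_. count_space UNIV))"
    by (intro sets_PiM_I_finite) auto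
  ultimately show ?case
    by (simp add: runs.C.simps)
next
  case (Suc n)
  let ?M = "\<lambda>_::nat. count_space UNIV :: ('a, 'b) conf measure"
  let ?u = "\<lambda>_::nat. undefined :: ('a, 'b) conf"
  let ?X = "\<lambda>n. PiE {0..<n} (\<lambda>i. {cs ! i})"
  let ?q = "emeasure (run_kernel P \<SS> s0 n (\<lambda>j. cs ! j)) {cs ! n}"
  have u: "?u \<in> space (PiM {0..<0} ?M)"
    by (simp add: space_PiM)
  have X: "?X m \<in> sets (PiM {0..<m} ?M)" for m
    by (intro sets_PiM_I_finite) auto
  have eP: "emeasure (runs.eP P \<SS> s0 n \<omega>) (?X (Suc n)) = ?q * indicator (?X n) \<omega>"
    if \<omega>: "\<omega> \<in> space (PiM {0..<n} ?M)" for \<omega>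
  proof -
    have ext: "\<omega> \<in> extensional {0..<n}"
      using \<omega> by (simp add: space_PiM PiE_iff)
    have "(fun_upd \<omega> n x \<in> ?X (Suc n)) = (\<omega> \<in> ?X n \<and> x = cs ! n)" for x
      using ext by (auto simp: PiE_iff extensional_def atLeastLessThanSuc split: if_splits)
    then have "(\<lambda>x. fun_upd \<omega> n x) -` ?X (Suc n) = (if \<omega> \<in> ?X n then {cs ! n} else {})"
      unfolding vimage_def by (simp only:) auto
    moreover have "run_kernel P \<SS> s0 n \<omega> = run_kernel P \<SS> s0 n (\<lambda>j. cs ! j)" if "\<omega> \<in> ?X n"
      using that by (cases n) (auto simp: PiE_iff)
    ultimately show ?thesis
      using runs.emeasure_eP[OF \<omega> X, of P \<SS> s0] by (auto split: split_indicator)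
  qed
  have C: "runs.C P \<SS> s0 0 n ?u \<in> space (subprob_algebra (PiM {0..<0 + n} ?M))"
    using measurable_space[OF runs.measurable_C u] .
  then have "emeasure (runs.C P \<SS> s0 0 (Suc n) ?u) (?X (Suc n)) =
      (\<integral>\<^sup>+ \<omega>. emeasure (runs.eP P \<SS> s0 n \<omega>) (?X (Suc n)) \<partial>runs.C P \<SS> s0 0 n ?u)"
  proof -
    have "space (runs.C P \<SS> s0 0 n ?u) \<noteq> {}"
      using runs.prob_space_C[OF u, THEN prob_space.not_empty] .
    moreover have "runs.eP P \<SS> s0 n \<in> measurable (runs.C P \<SS> s0 0 n ?u) (subprob_algebra (PiM {0..<Suc n} ?M))"
      using runs.measurable_eP[of P \<SS> s0 n] runs.sets_C[OF u, of P \<SS> s0 n]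
      by (simp cong: measurable_cong_sets)
    ultimately show ?thesis
      using X[of "Suc n"] by (simp add: runs.C.simps emeasure_bind)
  qed
  also have "\<dots> = (\<integral>\<^sup>+ \<omega>. ?q * indicator (?X n) \<omega> \<partial>runs.C P \<SS> s0 0 n ?u)"
    using eP by (intro nn_integral_cong) (simp add: runs.space_C[OF u])
  also have "\<dots> = ?q * emeasure (runs.C P \<SS> s0 0 n ?u) (?X n)"
    using X[of n] by (simp add: nn_integral_cmult_indicator runs.sets_C[OF u])
  finally show ?case
    using Suc.IH by (simp add: mult.commute)
qed

lemma run_measure_cylinder:
  assumes "cs \<noteq> []"
  shows "emeasure (run_measure P \<SS> s0) {\<omega>. \<forall>i<length cs. \<omega> i = cs ! i} = ennreal (path_prob P \<SS> s0 cs)"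
proof -
  let ?M = "\<lambda>_::nat. count_space UNIV :: ('a, 'b) conf measure"
  let ?X = "PiE {0..<length cs} (\<lambda>i. {cs ! i})"
  have X: "?X \<in> sets (PiM {0..<length cs} ?M)"
    by (intro sets_PiM_I_finite) auto
  have "{\<omega>. \<forall>i<length cs. \<omega> i = cs ! i} = prod_emb UNIV ?M {0..<length cs} ?X"
    by (auto simp: prod_emb_def space_PiM PiE_iff)
  then have "emeasure (run_measure P \<SS> s0) {\<omega>. \<forall>i<length cs. \<omega> i = cs ! i} =
      emeasure (runs.CI P \<SS> s0 {0..<length cs}) ?X"
    using runs.lim[OF _ X, of P \<SS> s0] by (simp add: run_measure_def)
  also have "\<dots> = emeasure (runs.C P \<SS> s0 0 (length cs) (\<lambda>_. undefined)) ?X"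
    using runs.emeasure_CI[OF _ X, of "length cs" P \<SS> s0] X sets.sets_into_space[OF X]
    by (simp add: prod_emb_id)
  also have "\<dots> = (\<Prod>i<length cs. emeasure (run_kernel P \<SS> s0 i (\<lambda>j. cs ! j)) {cs ! i})"
    by (rule emeasure_C_cylinder)
  also have "\<dots> = emeasure (measure_pmf (return_pmf (init_conf P s0))) {cs ! 0} *
      (\<Prod>i<length cs - 1. emeasure (measure_pmf (step_pmf \<SS> (cs ! i))) {cs ! Suc i})"
    using assms by (cases cs) (simp_all only: prod.lessThan_Suc_shift run_kernel.simps o_def list.size
        add_Suc_right diff_Suc_1 add_0_right One_nat_def, simp)
  also have "\<dots> = ennreal (path_prob P \<SS> s0 cs)"
    using assms by (auto simp: path_prob_def hd_conv_nth emeasure_pmf_single prod_ennreal prod_nonneg)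
  finally show ?thesis .
qed

end

theory Submission
  imports Defs
begin

text \<open>The rank of the current configuration, truncated at \<open>0\<close> and set to \<open>0\<close> at locations where no
  transition of \<open>GTni\<close> starts, is a potential: by the sign condition on \<open>GTni - GTgt\<close>, a step of
  \<open>GTni\<close> does not increase its expectation, and a step of \<open>GTgt\<close> decreases it by at least 1. So the
  expected number of steps of \<open>GTgt\<close> is at most the expected sum of the potentials at which runs
  enter \<open>GTni\<close>. For a non-constant rank at the entry location, the number of entries is bounded
  almost surely by \<open>RT\<close>, so this constant can be moved out of the expectation of (number of
  entries) times (supremum of the ranks), and linearity of the rank brings in \<open>SE\<close>. For a constant
  rank, only the expected number of entries matters.\<close>

section \<open>The law of a finite prefix of a run\<close>

text \<open>The obstacle in the drift estimate is the truncation: the expectation of max(0, rank)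
  can exceed max(0, expected rank), so Non-Increase alone says nothing about the truncated rank.
  Boundedness closes the gap. The successors of one configuration under one general transition of
  \<open>GTni\<close> have ranks that are all nonnegative, where truncation changes nothing, or all
  negative, where it leaves 0. For non-constant ranks, the number of entries and the sizes at the
  entries are dependent random variables, so a product of their expectations need not bound the
  expectation of their product. This is why the count is bounded by \<open>RT\<close>, pathwise, and
  only the size by an expectation. A constant rank is not random, so there the expected count is
  enough. All inequalities stay additive in \<open>ennreal\<close>: potentials are never subtracted,
  and the argument goes through even if some expected potential is infinite.\<close>

primrec path_pmf :: "('l, 'v::finite) pip \<Rightarrow> ('l, 'v) sched \<Rightarrow> 'v state \<Rightarrow> nat \<Rightarrow> ('l, 'v) conf list pmf" where
  "path_pmf P \<SS> s0 0 = return_pmf [init_conf P s0]"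
| "path_pmf P \<SS> s0 (Suc n) =
     bind_pmf (path_pmf P \<SS> s0 n) (\<lambda>cs. map_pmf (\<lambda>c. cs @ [c]) (step_pmf \<SS> (last cs)))"

lemma length_path_pmf: "cs \<in> set_pmf (path_pmf P \<SS> s0 n) \<Longrightarrow> length cs = Suc n"
  by (induction n arbitrary: cs) auto

lemma path_prob_snoc:
  assumes "cs \<noteq> []"
  shows "path_prob P \<SS> s0 (cs @ [c]) = path_prob P \<SS> s0 cs * pmf (step_pmf \<SS> (last cs)) c"
proof -
  obtain n where n: "length cs = Suc n"
    using assms by (cases cs) auto
  have "(\<Prod>i<n. pmf (step_pmf \<SS> ((cs @ [c]) ! i)) ((cs @ [c]) ! Suc i)) =
      (\<Prod>i<n. pmf (step_pmf \<SS> (cs ! i)) (cs ! Suc i))"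
    using n by (intro prod.cong) (auto simp: nth_append)
  then show ?thesis
    using assms n by (simp add: path_prob_def nth_append last_conv_nth)
qed

lemma pmf_path_pmf:
  assumes "length cs = Suc n"
  shows "pmf (path_pmf P \<SS> s0 n) cs = path_prob P \<SS> s0 cs"
  using assms
proof (induction n arbitrary: cs)
  case 0
  then show ?case
    by (auto simp: path_prob_def length_Suc_conv indicator_def)
next
  case (Suc n)
  then obtain bs c where cs: "cs = bs @ [c]" and bs: "length bs = Suc n"
    by (metis append_butlast_last_id length_append_singleton list.size(3) nat.distinct(1) nat.inject)
  have "bs \<noteq> []"
    using bs by auto
  have eq: "pmf (map_pmf (\<lambda>c. xs @ [c]) (step_pmf \<SS> (last xs))) (bs @ [c]) =
      pmf (step_pmf \<SS> (last bs)) c * indicator {bs} xs" for xs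
  proof (cases "xs = bs")
    case True
    then show ?thesis
      using pmf_map_inj'[of "\<lambda>c. bs @ [c]" _ c] by (simp add: inj_def)
  next
    case False
    then show ?thesis
      by (auto simp: pmf_eq_0_set_pmf)
  qed
  have "pmf (path_pmf P \<SS> s0 (Suc n)) cs =
      pmf (step_pmf \<SS> (last bs)) c * pmf (path_pmf P \<SS> s0 n) bs"
    by (simp add: cs pmf_bind eq measure_pmf_single)
  then show ?case
    using Suc.IH[OF bs] path_prob_snoc[OF \<open>bs \<noteq> []\<close>] by (simp add: cs)
qed

text \<open>The link that lets conditions on admissible paths, as in \<open>is_plrf\<close>, be used
  almost everywhere under an integral.\<close>

lemma set_path_pmf:
  "cs \<in> set_pmf (path_pmf P \<SS> s0 n) \<longleftrightarrow> length cs = Suc n \<and> admissible P \<SS> s0 cs"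
proof
  assume cs: "cs \<in> set_pmf (path_pmf P \<SS> s0 n)"
  then show "length cs = Suc n \<and> admissible P \<SS> s0 cs"
    using length_path_pmf[OF cs] pmf_path_pmf[of cs n] pmf_positive[OF cs]
    by (simp add: admissible_def)
next
  assume cs: "length cs = Suc n \<and> admissible P \<SS> s0 cs"
  then show "cs \<in> set_pmf (path_pmf P \<SS> s0 n)"
    using pmf_path_pmf[of cs n P \<SS> s0] by (simp add: admissible_def set_pmf_iff)
qed

lemma sets_run_measure [measurable_cong, simp]:
  "sets (run_measure P \<SS> s0) = sets (PiM UNIV (\<lambda>_. count_space UNIV))"
  by (simp add: run_measure_def)

lemma space_run_measure [simp]: "space (run_measure P \<SS> s0) = UNIV"
  by (simp add: run_measure_def space_PiM)

lemma measurable_run_nth: "(\<lambda>\<omega>. \<omega> i) \<in> measurable (run_measure P \<SS> s0) (count_space UNIV)"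
  unfolding measurable_cong_sets[OF sets_run_measure refl]
  by (rule measurable_component_singleton) simp

lemma measurable_run_component [measurable]:
  "f \<in> measurable (count_space UNIV) N \<Longrightarrow> (\<lambda>\<omega>. f (\<omega> i)) \<in> measurable (run_measure P \<SS> s0) N"
  by (rule measurable_compose[OF measurable_run_nth])

text \<open>A subset of the support is countable, so the event is a countable disjoint union of
  cylinders, and \<open>run_measure_cylinder\<close> measures each of them. The type of
  configurations itself is uncountable, because transitions contain arbitrary functions.\<close>

lemma emeasure_run_prefix:
  assumes "A \<subseteq> set_pmf (path_pmf P \<SS> s0 n)"
  shows "{\<omega>. map \<omega> [0..<Suc n] \<in> A} \<in> sets (run_measure P \<SS> s0)"
    and "emeasure (run_measure P \<SS> s0) {\<omega>. map \<omega> [0..<Suc n] \<in> A} =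
      emeasure (measure_pmf (path_pmf P \<SS> s0 n)) A"
proof -
  let ?M = "run_measure P \<SS> s0"
  let ?cyl = "\<lambda>cs. {\<omega>. \<forall>i<length cs. \<omega> i = cs ! i}"
  have count: "countable A"
    using assms countable_set_pmf countable_subset by blast
  have len: "length cs = Suc n" if "cs \<in> A" for cs
    using that assms length_path_pmf by blast
  have cyl: "?cyl cs = {\<omega>. map \<omega> [0..<Suc n] = cs}" if "cs \<in> A" for cs
    using len[OF that] by (auto simp: list_eq_iff_nth_eq simp del: upt_Suc)
  have meas: "?cyl cs \<in> sets ?M" for cs
  proof -
    have "{\<omega>\<in>space ?M. \<forall>i\<in>{..<length cs}. \<omega> i = cs ! i} \<in> sets ?M"
      by measurable
    then show ?thesis
      by (simp add: Ball_def)
  qed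
  have un: "{\<omega>. map \<omega> [0..<Suc n] \<in> A} = (\<Union>cs\<in>A. ?cyl cs)"
    using cyl by auto
  show "{\<omega>. map \<omega> [0..<Suc n] \<in> A} \<in> sets ?M"
    unfolding un using count meas by (intro sets.countable_UN') blast+
  have "emeasure ?M {\<omega>. map \<omega> [0..<Suc n] \<in> A} = (\<integral>\<^sup>+cs. emeasure ?M (?cyl cs) \<partial>count_space A)"
    unfolding un
  proof (rule emeasure_UN_countable)
    show "disjoint_family_on ?cyl A"
      unfolding disjoint_family_on_def using cyl by auto
  qed (use count meas in blast)+
  also have "\<dots> = (\<integral>\<^sup>+cs. pmf (path_pmf P \<SS> s0 n) cs \<partial>count_space A)"
  proof (intro nn_integral_cong)
    fix cs assume "cs \<in> space (count_space A)"
    then have "length cs = Suc n"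
      using len by simp
    then show "emeasure ?M (?cyl cs) = ennreal (pmf (path_pmf P \<SS> s0 n) cs)"
      by (subst run_measure_cylinder) (auto simp: pmf_path_pmf)
  qed
  also have "\<dots> = emeasure (measure_pmf (path_pmf P \<SS> s0 n)) A"
    by (rule nn_integral_pmf)
  finally show "emeasure ?M {\<omega>. map \<omega> [0..<Suc n] \<in> A} = emeasure (measure_pmf (path_pmf P \<SS> s0 n)) A" .
qed

lemma prob_space_run_measure: "prob_space (run_measure P \<SS> s0)"
proof (rule prob_spaceI)
  \<comment> \<open>The cylinder over the empty index set is the whole space of runs.\<close>
  have "emeasure (run_measure P \<SS> s0) (prod_emb UNIV (\<lambda>_. count_space UNIV) {} (space (PiM {} (\<lambda>_. count_space UNIV)))) =
      emeasure (runs.CI P \<SS> s0 {}) (space (PiM {} (\<lambda>_. count_space UNIV)))"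
    unfolding run_measure_def by (rule runs.lim) auto
  also have "\<dots> = emeasure (runs.CI P \<SS> s0 {}) (space (runs.CI P \<SS> s0 {}))"
    by (simp add: runs.CI_def)
  also have "\<dots> = 1"
    by (rule prob_space.emeasure_space_1[OF runs.PF.prob_space_P]) auto
  finally show "emeasure (run_measure P \<SS> s0) (space (run_measure P \<SS> s0)) = 1"
    by (simp add: prod_emb_def space_PiM vimage_def restrict_def)
qed

text \<open>For each length the support of \<open>path_pmf\<close> has full measure, and there are
  only countably many lengths.\<close>

lemma AE_run_prefix: "AE \<omega> in run_measure P \<SS> s0. \<forall>n. admissible P \<SS> s0 (map \<omega> [0..<Suc n])"
proof -
  interpret prob_space "run_measure P \<SS> s0"
    by (rule prob_space_run_measure)
  have "AE \<omega> in run_measure P \<SS> s0. map \<omega> [0..<Suc n] \<in> set_pmf (path_pmf P \<SS> s0 n)" for n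
  proof (rule AE_I_eq_1)
    show "{\<omega>\<in>space (run_measure P \<SS> s0). map \<omega> [0..<Suc n] \<in> set_pmf (path_pmf P \<SS> s0 n)}
        \<in> sets (run_measure P \<SS> s0)"
      using emeasure_run_prefix(1)[OF subset_refl[of "set_pmf (path_pmf P \<SS> s0 n)"]] by simp
    show "emeasure (run_measure P \<SS> s0)
        {\<omega>\<in>space (run_measure P \<SS> s0). map \<omega> [0..<Suc n] \<in> set_pmf (path_pmf P \<SS> s0 n)} = 1"
      using emeasure_run_prefix(2)[OF subset_refl[of "set_pmf (path_pmf P \<SS> s0 n)"]]
      by (simp add: measure_pmf.emeasure_eq_1_AE AE_measure_pmf)
  qed
  then show ?thesis
    by (simp add: AE_all_countable set_path_pmf del: upt_Suc)
qed

lemma nn_integral_run_component: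
  "(\<integral>\<^sup>+\<omega>. f (\<omega> n) \<partial>run_measure P \<SS> s0) = (\<integral>\<^sup>+cs. f (last cs) \<partial>measure_pmf (path_pmf P \<SS> s0 n))"
proof -
  let ?M = "run_measure P \<SS> s0" and ?L = "path_pmf P \<SS> s0 n"
  have distr: "distr ?M (count_space UNIV) (\<lambda>\<omega>. \<omega> n) = measure_pmf (map_pmf last ?L)"
  proof (rule measure_eqI)
    fix A :: "('a, 'b) conf set"
    \<comment> \<open>\<open>A\<close> may be uncountable; intersecting with the support makes
      \<open>emeasure_run_prefix\<close> applicable and changes the event only on a null
      set.\<close>
    let ?A = "{cs\<in>set_pmf ?L. last cs \<in> A}"
    have "emeasure (distr ?M (count_space UNIV) (\<lambda>\<omega>. \<omega> n)) A = emeasure ?M {\<omega>. \<omega> n \<in> A}"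
      using measurable_run_nth by (simp add: emeasure_distr vimage_def)
    also have "\<dots> = emeasure ?M {\<omega>. map \<omega> [0..<Suc n] \<in> ?A}"
    proof (rule emeasure_eq_AE)
      show "AE \<omega> in ?M. (\<omega> \<in> {\<omega>. \<omega> n \<in> A}) = (\<omega> \<in> {\<omega>. map \<omega> [0..<Suc n] \<in> ?A})"
        using AE_run_prefix[of P \<SS> s0]
      proof eventually_elim
        case (elim \<omega>)
        then have "map \<omega> [0..<Suc n] \<in> set_pmf ?L"
          by (simp add: set_path_pmf del: upt_Suc)
        then show ?case
          by simp
      qed
      show "{\<omega>. \<omega> n \<in> A} \<in> sets ?M"
        using measurable_sets[OF measurable_run_nth, of A] by (simp add: vimage_def)
      show "{\<omega>. map \<omega> [0..<Suc n] \<in> ?A} \<in> sets ?M"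
        by (rule emeasure_run_prefix(1)) auto
    qed
    also have "\<dots> = emeasure ?L ?A"
      by (rule emeasure_run_prefix(2)) auto
    also have "\<dots> = emeasure ?L (last -` A)"
      by (rule emeasure_eq_AE) (auto simp: AE_measure_pmf_iff)
    finally show "emeasure (distr ?M (count_space UNIV) (\<lambda>\<omega>. \<omega> n)) A = emeasure (map_pmf last ?L) A"
      by simp
  qed simp
  have "(\<integral>\<^sup>+\<omega>. f (\<omega> n) \<partial>?M) = (\<integral>\<^sup>+c. f c \<partial>distr ?M (count_space UNIV) (\<lambda>\<omega>. \<omega> n))"
    by (rule nn_integral_distr[symmetric, OF measurable_run_nth]) simp
  then show ?thesis
    unfolding distr by simp
qed

lemma nn_integral_path_pmf_Suc:
  "(\<integral>\<^sup>+cs. f (last cs) \<partial>measure_pmf (path_pmf P \<SS> s0 (Suc n))) =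
   (\<integral>\<^sup>+cs. (\<integral>\<^sup>+c. f c \<partial>measure_pmf (step_pmf \<SS> (last cs))) \<partial>measure_pmf (path_pmf P \<SS> s0 n))"
  by simp

lemma gtrans_count_eq: "gtrans_count g \<omega> = (suminf (\<lambda>i. indicator {c. fst (snd c) \<in> T_ex ` g} (\<omega> i)))"
proof -
  have "gtrans_count g \<omega> = (\<integral>\<^sup>+i. indicator {i. fst (snd (\<omega> i)) \<in> T_ex ` g} i \<partial>count_space UNIV)"
    by (simp add: gtrans_count_def)
  also have "\<dots> = (suminf (\<lambda>i. indicator {c. fst (snd c) \<in> T_ex ` g} (\<omega> i)))"
    by (subst nn_integral_count_space_nat) (simp add: indicator_def [abs_def])
  finally show ?thesis .
qed

text \<open>Tonelli. The number of steps of \<open>g\<close> and the total rank at the entries both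
  have this form, so comparing them involves only the laws of single positions.\<close>

lemma run_expectation_suminf:
  "run_expectation P \<SS> s0 (\<lambda>\<omega>. suminf (\<lambda>i. f (\<omega> i))) =
   suminf (\<lambda>i. \<integral>\<^sup>+cs. f (last cs) \<partial>measure_pmf (path_pmf P \<SS> s0 i))"
  unfolding run_expectation_def
  by (subst nn_integral_suminf) (auto intro!: measurable_run_component simp: nn_integral_run_component)

section \<open>Expected value of a linear ranking function after one step\<close>

lemma mono_degree_le_1_cases:
  assumes "mono_degree m \<le> 1"
  obtains (one) "Poly_Mapping.keys m = {}"
  | (var) x where "Poly_Mapping.keys m = {x}" "Poly_Mapping.lookup m x = 1"
proof (cases "Poly_Mapping.keys m = {}")
  case True
  then show ?thesis
    by (rule one)
next
  case False
  then obtain x where x: "x \<in> Poly_Mapping.keys m"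
    by blast
  let ?K = "Poly_Mapping.keys m - {x}"
  have pos: "1 \<le> Poly_Mapping.lookup m y" if "y \<in> Poly_Mapping.keys m" for y
    using that by (metis in_keys_iff less_one not_le)
  have "Poly_Mapping.lookup m x + (\<Sum>y\<in>?K. Poly_Mapping.lookup m y) \<le> 1"
    using assms x by (simp add: mono_degree_def flip: sum.remove)
  moreover have "card ?K \<le> (\<Sum>y\<in>?K. Poly_Mapping.lookup m y)"
    using sum_mono[of ?K "\<lambda>_. 1" "Poly_Mapping.lookup m"] pos by auto
  ultimately have "card ?K = 0" "Poly_Mapping.lookup m x = 1"
    using pos[OF x] by linarith+
  then show ?thesis
    using var[of x] x by (metis Diff_eq_empty_iff card_0_eq finite_Diff finite_keys subset_singletonD empty_iff)
qed

lemma expectation_var_upd_pmf: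
  assumes "\<forall>x d. \<eta> x = Some (Sample d) \<longrightarrow> d \<in> distfuns"
  shows "integrable (measure_pmf (var_upd_pmf \<eta> s x)) real_of_int"
    and "measure_pmf.expectation (var_upd_pmf \<eta> s x) real_of_int = upd_expectation s \<eta> x"
  using assms by (auto simp: var_upd_pmf_def upd_expectation_def distfuns_def
      intro!: integrable_measure_pmf_finite split: option.split upd.split)

text \<open>A monomial of degree at most 1 is constant or a single variable, so linearity and the
  expectations of the single variables suffice. For a square, evaluating at the expected values
  would already be wrong.\<close>

lemma expectation_state_upd_pmf:
  assumes "deg_le p 1" and samples: "\<forall>x d. \<eta> x = Some (Sample d) \<longrightarrow> d \<in> distfuns"
  shows "integrable (measure_pmf (state_upd_pmf \<eta> s)) (\<lambda>s'. reval s' p)"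
    and "measure_pmf.expectation (state_upd_pmf \<eta> s) (\<lambda>s'. reval s' p) = peval (upd_expectation s \<eta>) p"
proof -
  let ?D = "measure_pmf (state_upd_pmf \<eta> s)"
  have comp: "map_pmf (\<lambda>s'. s' x) (state_upd_pmf \<eta> s) = var_upd_pmf \<eta> s x" for x
    unfolding state_upd_pmf_def by (subst Pi_pmf_component) auto
  have var: "integrable ?D (\<lambda>s'. real_of_int (s' x))"
    "integral\<^sup>L ?D (\<lambda>s'. real_of_int (s' x)) = upd_expectation s \<eta> x" for x
    using expectation_var_upd_pmf[OF samples, of s x] by (simp_all flip: comp)
  have mono: "integrable ?D (\<lambda>s'. mono_eval (\<lambda>x. real_of_int (s' x)) m) \<and>
      integral\<^sup>L ?D (\<lambda>s'. mono_eval (\<lambda>x. real_of_int (s' x)) m) = mono_eval (upd_expectation s \<eta>) m"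
    if "m \<in> Poly_Mapping.keys p" for m
  proof -
    have "mono_degree m \<le> 1"
      using assms(1) that by (simp add: deg_le_def)
    then show ?thesis
      by (cases rule: mono_degree_le_1_cases) (simp_all add: mono_eval_def var)
  qed
  show "integrable ?D (\<lambda>s'. reval s' p)"
    unfolding reval_def peval_def using mono by (intro Bochner_Integration.integrable_sum integrable_mult_right) auto
  show "integral\<^sup>L ?D (\<lambda>s'. reval s' p) = peval (upd_expectation s \<eta>) p"
    unfolding reval_def peval_def using mono
    by (subst Bochner_Integration.integral_sum) (auto intro!: integrable_mult_right sum.cong)
qed

lemma nn_integral_gtrans_pmf:
  assumes "is_gtrans P g"
  shows "(\<integral>\<^sup>+t. f t \<partial>measure_pmf (gtrans_pmf g)) = (\<Sum>t\<in>g. ennreal (tprob t) * f t)"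
proof -
  have "finite g"
    using assms by (simp add: is_gtrans_def)
  then have "(\<integral>\<^sup>+t. f t \<partial>measure_pmf (gtrans_pmf g)) = (\<Sum>t\<in>g. f t * ennreal (pmf (gtrans_pmf g) t))"
    by (rule nn_integral_measure_pmf_support)
      (auto simp: set_pmf_iff pmf_gtrans_pmf[OF assms])
  also have "\<dots> = (\<Sum>t\<in>g. ennreal (tprob t) * f t)"
    by (intro sum.cong) (auto simp: pmf_gtrans_pmf[OF assms] mult.commute)
  finally show ?thesis .
qed

lemma set_gtrans_pmf:
  assumes "is_gtrans P g"
  shows "set_pmf (gtrans_pmf g) = {t \<in> g. tprob t \<noteq> 0}"
  by (auto simp: set_pmf_iff pmf_gtrans_pmf[OF assms] split: if_splits)

text \<open>The step after the choice of \<open>(g, s)\<close>, detached from any scheduler. The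
  drift estimates can thus be stated for every enabled choice, not only for the one that the
  scheduler makes.\<close>

definition gstep_pmf :: "('l, 'v::finite) gtrans \<Rightarrow> 'v state \<Rightarrow> ('l, 'v) conf pmf" where
  "gstep_pmf g s = bind_pmf (gtrans_pmf g)
     (\<lambda>t. map_pmf (\<lambda>s'. (Some (tgt t), T_ex t, s')) (state_upd_pmf (eta t) s))"

lemma set_gstep_pmf:
  assumes "is_gtrans P g" "c \<in> set_pmf (gstep_pmf g s)"
  obtains t s' where "c = (Some (tgt t), T_ex t, s')" "t \<in> g"
  using assms by (auto simp: gstep_pmf_def set_gtrans_pmf[OF assms(1)])

text \<open>The rank is truncated at \<open>0\<close> (by \<open>ennreal\<close>) and outside of \<open>L\<close>.\<close>

definition rank_pot :: "('l \<Rightarrow> ('v, real) mpoly) \<Rightarrow> 'l set \<Rightarrow> ('l, 'v) conf \<Rightarrow> ennreal" where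
  "rank_pot r L c = (case c of (Some l, _, s) \<Rightarrow> if l \<in> L then ennreal (reval s (r l)) else 0 | _ \<Rightarrow> 0)"

text \<open>Where all successor ranks are nonnegative, the truncated integral is the true
  expectation; setting the rank to 0 outside of \<open>L\<close> can then only lower it.\<close>

lemma nn_integral_rank_pot_gstep_le:
  assumes g: "is_gtrans P g" and deg: "\<forall>t\<in>g. deg_le (r (tgt t)) 1"
    and nonneg: "\<And>l t s'. (Some l, T_ex t, s') \<in> set_pmf (gstep_pmf g s) \<Longrightarrow> 0 \<le> reval s' (r l)"
  shows "0 \<le> exp_rank r g s"
    and "(\<integral>\<^sup>+c. rank_pot r L c \<partial>measure_pmf (gstep_pmf g s)) \<le> ennreal (exp_rank r g s)"
proof -
  let ?e = "\<lambda>t. tprob t * peval (upd_expectation s (eta t)) (r (tgt t))"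
  have summand: "0 \<le> ?e t \<and>
      ennreal (tprob t) * (\<integral>\<^sup>+s'. ennreal (reval s' (r (tgt t))) \<partial>measure_pmf (state_upd_pmf (eta t) s))
        = ennreal (?e t)" if "t \<in> g" for t
  \<comment> \<open>A transition of probability 0 is outside the support, so \<open>nonneg\<close>
    says nothing about its rank; but its summand vanishes.\<close>
  proof (cases "tprob t = 0")
    case False
    have t: "is_trans P t"
      using g that by (simp add: is_gtrans_def)
    then have samples: "\<forall>x d. eta t x = Some (Sample d) \<longrightarrow> d \<in> distfuns" and p: "0 \<le> tprob t"
      by (auto simp: is_trans_def)
    have "0 \<le> reval s' (r (tgt t))" if "s' \<in> set_pmf (state_upd_pmf (eta t) s)" for s'
      using that \<open>t \<in> g\<close> False
      by (intro nonneg[of "tgt t" t s']) (auto simp: gstep_pmf_def set_gtrans_pmf[OF g])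
    then have ae: "AE s' in measure_pmf (state_upd_pmf (eta t) s). 0 \<le> reval s' (r (tgt t))"
      by (simp add: AE_measure_pmf_iff)
    note ex = expectation_state_upd_pmf[OF bspec[OF deg that] samples, of s]
    have "(\<integral>\<^sup>+s'. ennreal (reval s' (r (tgt t))) \<partial>measure_pmf (state_upd_pmf (eta t) s)) =
        ennreal (peval (upd_expectation s (eta t)) (r (tgt t)))"
      using nn_integral_eq_integral[OF ex(1) ae] ex(2) by simp
    moreover have "0 \<le> peval (upd_expectation s (eta t)) (r (tgt t))"
      using integral_nonneg_AE[OF ae] ex(2) by simp
    ultimately show ?thesis
      using p by (simp add: ennreal_mult)
  qed simp
  then show "0 \<le> exp_rank r g s"
    unfolding exp_rank_def by (intro sum_nonneg) auto
  have "(\<integral>\<^sup>+c. rank_pot r L c \<partial>measure_pmf (gstep_pmf g s)) =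
      (\<Sum>t\<in>g. ennreal (tprob t) *
        (\<integral>\<^sup>+s'. rank_pot r L (Some (tgt t), T_ex t, s') \<partial>measure_pmf (state_upd_pmf (eta t) s)))"
    by (simp add: gstep_pmf_def nn_integral_gtrans_pmf[OF g])
  also have "\<dots> \<le> (\<Sum>t\<in>g. ennreal (tprob t) *
        (\<integral>\<^sup>+s'. ennreal (reval s' (r (tgt t))) \<partial>measure_pmf (state_upd_pmf (eta t) s)))"
    by (intro sum_mono mult_left_mono nn_integral_mono) (auto simp: rank_pot_def)
  also have "\<dots> = (\<Sum>t\<in>g. ennreal (?e t))"
    using summand by (intro sum.cong) auto
  also have "\<dots> = ennreal (exp_rank r g s)"
    unfolding exp_rank_def using summand by (intro sum_ennreal) auto
  finally show "(\<integral>\<^sup>+c. rank_pot r L c \<partial>measure_pmf (gstep_pmf g s)) \<le> ennreal (exp_rank r g s)" .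
qed

section \<open>Admissible paths and schedulers\<close>

lemma admissible_single: "admissible P \<SS> s0 [c] \<longleftrightarrow> c = init_conf P s0"
  by (simp add: admissible_def path_prob_def)

lemma admissible_snoc:
  assumes "cs \<noteq> []"
  shows "admissible P \<SS> s0 (cs @ [c]) \<longleftrightarrow> admissible P \<SS> s0 cs \<and> c \<in> set_pmf (step_pmf \<SS> (last cs))"
proof -
  have "0 \<le> path_prob P \<SS> s0 cs"
    by (auto simp: path_prob_def intro: prod_nonneg)
  then show ?thesis
    by (auto simp: admissible_def path_prob_snoc[OF assms] zero_less_mult_iff set_pmf_iff
        order.strict_iff_order)
qed

lemma admissible_nonempty: "admissible P \<SS> s0 cs \<Longrightarrow> cs \<noteq> []"
  by (auto simp: admissible_def path_prob_def)

lemma admissible_append: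
  assumes "admissible P \<SS> s0 (xs @ ys)" "xs \<noteq> []"
  shows "admissible P \<SS> s0 xs"
  using assms
proof (induction ys rule: rev_induct)
  case (snoc y ys)
  then show ?case
    using admissible_snoc[of "xs @ ys"] by (simp flip: append_assoc)
qed simp

text \<open>The scheduler is consulted only in the configurations that the path leaves. Hence
  \<open>c\<close> may be the last configuration \<open>c'\<close>, which is the case of
  interest.\<close>

lemma admissible_fun_upd:
  assumes "admissible P \<SS> s0 (xs @ [c'])" "c \<notin> set xs"
  shows "admissible P (\<SS>(c := a)) s0 (xs @ [c'])"
  using assms
proof (induction xs arbitrary: c' rule: rev_induct)
  case (snoc x xs)
  have "step_pmf (\<SS>(c := a)) x = step_pmf \<SS> x"
    using snoc.prems(2) by (auto simp: step_pmf_def)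
  with snoc show ?case
    using admissible_snoc[of "xs @ [x]" P \<SS> s0 c'] admissible_snoc[of "xs @ [x]" P "\<SS>(c := a)" s0 c']
    by (simp del: fun_upd_apply)
qed (simp add: admissible_single)

lemma is_schedulerD:
  assumes "is_scheduler P \<SS>" "(l, t, s) \<in> confs P" "\<SS> (l, t, s) = (Some g, s')"
  shows "(g, s') \<in> choices P l s" and "t \<noteq> T_bot"
  using bspec[OF assms(1)[unfolded is_scheduler_def] assms(2)] assms(3) by (auto split: if_splits)

lemma is_scheduler_fun_upd:
  assumes \<SS>: "is_scheduler P \<SS>" and choice: "(g, s') \<in> choices P l s" "t \<noteq> T_bot"
  shows "is_scheduler P (\<SS>((l, t, s) := (Some g, s')))"
proof -
  have ne: "l \<noteq> None" "choices P l s \<noteq> {}"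
    using choice(1) by (auto simp: choices_def)
  show ?thesis
    unfolding is_scheduler_def
  proof (rule ballI)
    fix c assume c: "c \<in> confs P"
    obtain l2 t2 s2 where c_eq: "c = (l2, t2, s2)"
      by (cases c)
    show "case c of (l2, t2, s2) \<Rightarrow> if l2 = None \<or> t2 = T_bot \<or> choices P l2 s2 = {}
        then (\<SS>((l, t, s) := (Some g, s'))) (l2, t2, s2) = (None, s2)
        else \<exists>(g', s'')\<in>choices P l2 s2. (\<SS>((l, t, s) := (Some g, s'))) (l2, t2, s2) = (Some g', s'')"
    proof (cases "c = (l, t, s)")
      case True
      then show ?thesis
        using ne choice c_eq by auto
    next
      case False
      then have "(\<SS>((l, t, s) := (Some g, s'))) (l2, t2, s2) = \<SS> (l2, t2, s2)"
        using c_eq by auto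
      then show ?thesis
        using bspec[OF \<SS>[unfolded is_scheduler_def] c] c_eq by (simp only: prod.case)
    qed
  qed
qed

lemma step_pmf_Some: "\<SS> c = (Some g, s) \<Longrightarrow> step_pmf \<SS> c = gstep_pmf g s"
  by (simp add: step_pmf_def gstep_pmf_def)

lemma step_pmf_None: "\<SS> c = (None, s) \<Longrightarrow> step_pmf \<SS> c = return_pmf (None, T_bot, s)"
  by (simp add: step_pmf_def)

text \<open>\<open>is_scheduler\<close> constrains a scheduler on \<open>confs P\<close> only, so
  reachable configurations must be shown to lie there before a choice can be analysed.\<close>

lemma admissible_confs:
  assumes P: "is_pip P" and \<SS>: "is_scheduler P \<SS>" and "admissible P \<SS> s0 (cs @ [c])"
  shows "c \<in> confs P"
  using assms(3)
proof (induction cs arbitrary: c rule: rev_induct)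
  case Nil
  then show ?case
    using P by (auto simp: admissible_single init_conf_def confs_def is_pip_def)
next
  case (snoc x xs)
  then have x: "x \<in> confs P" and c: "c \<in> set_pmf (step_pmf \<SS> x)"
    using admissible_snoc[of "xs @ [x]" P \<SS> s0 c] by simp_all
  obtain l t s where lts: "x = (l, t, s)"
    by (cases x)
  show ?case
  proof (cases "\<SS> x")
    case (Pair a s')
    show ?thesis
    proof (cases a)
      case None
      then show ?thesis
        using c Pair by (simp add: step_pmf_None confs_def)
    next
      case (Some g)
      then have "g \<in> GT P"
        using is_schedulerD(1)[OF \<SS> x[unfolded lts], of g s'] Pair lts by (simp add: choices_def)
      moreover from this have g: "is_gtrans P g"
        using P by (simp add: is_pip_def)
      have "c \<in> set_pmf (gstep_pmf g s')"
        using c Pair Some by (simp add: step_pmf_Some)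
      then obtain t s'' where "c = (Some (tgt t), T_ex t, s'')" "t \<in> g"
        by (rule set_gstep_pmf[OF g])
      ultimately show ?thesis
        using g unfolding confs_def transitions_def is_gtrans_def is_trans_def by blast
    qed
  qed
qed

text \<open>Cutting the path at its first visit of \<open>c\<close> allows to redefine the scheduler in \<open>c\<close>.\<close>

lemma adm_step_choice:
  assumes P: "is_pip P" and \<SS>: "is_scheduler P \<SS>" and adm: "admissible P \<SS> s0 (cs @ [(l, t, s)])"
    and choice: "(g, s') \<in> choices P l s" "t \<noteq> T_bot" and c': "c' \<in> set_pmf (gstep_pmf g s')"
  shows "adm_step P (l, t, s) c'"
proof -
  let ?c = "(l, t, s)"
  let ?\<SS> = "\<SS>(?c := (Some g, s'))"
  obtain ys zs where split: "cs @ [?c] = ys @ ?c # zs" and first: "?c \<notin> set ys"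
    using split_list_first[of ?c "cs @ [?c]"] by auto
  have "admissible P \<SS> s0 (ys @ [?c])"
    using adm unfolding split by (intro admissible_append[of _ _ _ "ys @ [?c]" zs]) simp_all
  then have "admissible P ?\<SS> s0 (ys @ [?c])"
    using first by (rule admissible_fun_upd)
  moreover have "c' \<in> set_pmf (step_pmf ?\<SS> ?c)"
    using c' by (simp add: step_pmf_Some)
  ultimately have "admissible P ?\<SS> s0 (ys @ [?c, c'])"
    using admissible_snoc[of "ys @ [?c]" P ?\<SS> s0 c'] by simp
  moreover have "is_scheduler P ?\<SS>"
    using \<SS> choice by (rule is_scheduler_fun_upd)
  ultimately show ?thesis
    unfolding adm_step_def by blast
qed

section \<open>Expected change of the rank\<close>

lemma reval_agree_on:
  assumes "pvarset p \<subseteq> X" "agree_on X s s'"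
  shows "reval s' p = reval s p"
proof -
  have "mono_eval (\<lambda>x. real_of_int (s' x)) m = mono_eval (\<lambda>x. real_of_int (s x)) m"
    if "m \<in> Poly_Mapping.keys p" for m
    unfolding mono_eval_def
  proof (rule prod.cong)
    fix x assume "x \<in> Poly_Mapping.keys m"
    then have "x \<in> X"
      using assms(1) that unfolding pvarset_def by blast
    then show "real_of_int (s' x) ^ Poly_Mapping.lookup m x = real_of_int (s x) ^ Poly_Mapping.lookup m x"
      using assms(2) by (simp add: agree_on_def)
  qed simp
  then show ?thesis
    by (simp add: reval_def peval_def)
qed

lemma gsrc_gguard_eq:
  assumes "is_gtrans P g" "t \<in> g"
  shows "gsrc g = src t" "gguard g = guard t"
proof -
  have all: "\<forall>t\<in>g. \<forall>t'\<in>g. src t = src t' \<and> guard t = guard t'"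
    using assms(1) unfolding is_gtrans_def by (elim conjE)
  have eq: "src u = src t \<and> guard u = guard t" if "u \<in> g" for u
    using bspec[OF bspec[OF all that] assms(2)] .
  have "src ` g = (\<lambda>_. src t) ` g" "guard ` g = (\<lambda>_. guard t) ` g"
    by (intro image_cong refl eq[THEN conjunct1] eq[THEN conjunct2]; assumption)+
  then have "src ` g = {src t}" "guard ` g = {guard t}"
    using assms(2) by auto
  then show "gsrc g = src t" "gguard g = guard t"
    by (simp_all add: gsrc_def gguard_def)
qed

text \<open>The conditions of \<open>is_plrf\<close> concern configurations that have a predecessor;
  \<open>no_init\<close> keeps \<open>GTni\<close> away from the initial configuration, which has
  none and where the potential has to start at 0. \<open>disj\<close> rules out that a step chosen
  from \<open>GTni - GTgt\<close>, whose rank need not decrease, is counted for some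
  \<open>g\<close> in \<open>GTgt\<close> through a shared transition.\<close>

locale ranked_pip =
  fixes P :: "('l, 'v::finite) pip"
    and r :: "'l \<Rightarrow> ('v, real) mpoly"
    and GTgt GTni :: "('l, 'v) gtrans set"
  assumes pip: "is_pip P"
    and plrf: "is_plrf P r GTgt GTni"
    and no_init: "\<And>g. g \<in> GTni \<Longrightarrow> gsrc g \<noteq> init_loc P"
    and disj: "\<And>g h. g \<in> GTgt \<Longrightarrow> h \<in> GTni - GTgt \<Longrightarrow> g \<inter> h = {}"
begin

text \<open>Chosen to match \<open>entry_locs\<close>: reaching any other location by an outside
  step gives potential 0, so the bound does not have to pay for it.\<close>

definition ni_locs :: "'l set" where
  "ni_locs = src ` (\<Union>GTni)"

abbreviation pot :: "('l, 'v) conf \<Rightarrow> ennreal" where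
  "pot \<equiv> rank_pot r ni_locs"

lemma GT_subsets: "GTgt \<subseteq> GTni" "GTni \<subseteq> GT P"
  using plrf by (simp_all add: is_plrf_def)

lemma is_gtrans_GT: "g \<in> GT P \<Longrightarrow> is_gtrans P g"
  using pip by (simp add: is_pip_def)

lemma src_tgt_locs: "g \<in> GT P \<Longrightarrow> t \<in> g \<Longrightarrow> src t \<in> locs P \<and> tgt t \<in> locs P"
  using is_gtrans_GT[of g] unfolding is_gtrans_def is_trans_def by blast

lemma gsrc_attained: "g \<in> GT P \<Longrightarrow> \<exists>t\<in>g. gsrc g = src t"
  using is_gtrans_GT[of g] gsrc_gguard_eq(1)[of P g] unfolding is_gtrans_def by blast

lemma gsrc_locs: "g \<in> GT P \<Longrightarrow> gsrc g \<in> locs P"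
  using gsrc_attained[of g] src_tgt_locs[of g] by auto

lemma ni_locs_eq: "ni_locs = gsrc ` GTni"
proof -
  have "src ` g = {gsrc g}" if "g \<in> GTni" for g
  proof -
    have "g \<in> GT P"
      using that GT_subsets by blast
    then obtain t where "t \<in> g" "gsrc g = src t"
      using gsrc_attained by blast
    moreover have "src u = gsrc g" if "u \<in> g" for u
      using gsrc_gguard_eq(1)[OF is_gtrans_GT[OF \<open>g \<in> GT P\<close>] that] by (rule sym)
    ultimately show ?thesis
      by (metis image_constant_conv image_cong empty_iff)
  qed
  then have "(\<Union>g\<in>GTni. src ` g) = (\<Union>g\<in>GTni. {gsrc g})"
    by (rule SUP_cong[OF refl])
  then show ?thesis
    unfolding ni_locs_def by (simp add: image_Union UNION_singleton_eq_range)
qed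

lemma gsrc_ni_locs: "g \<in> GTni \<Longrightarrow> gsrc g \<in> ni_locs"
  by (simp add: ni_locs_eq)

lemma init_notin_ni_locs: "init_loc P \<notin> ni_locs"
  unfolding ni_locs_eq using no_init by (metis imageE)

lemma rank_linear:
  assumes "l \<in> locs P"
  shows "pvarset (r l) \<subseteq> PV P" "deg_le (r l) 1"
  using plrf assms by (simp_all add: is_plrf_def)

lemma rank_sign:
  assumes "g \<in> GTni - GTgt"
  shows "(\<forall>l t s. adm_step P c (Some l, T_ex t, s) \<and> t \<in> g \<longrightarrow> reval s (r l) < 0) \<or>
    (\<forall>l t s. adm_step P c (Some l, T_ex t, s) \<and> t \<in> g \<longrightarrow> reval s (r l) \<ge> 0)"
  using spec[OF bspec[OF plrf[unfolded is_plrf_def, THEN conjunct2, THEN conjunct2, THEN conjunct2,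
      THEN conjunct1] assms], of c] .

lemma rank_nonneg:
  "g \<in> GTgt \<Longrightarrow> adm_step P c (Some l, T_ex t, s) \<Longrightarrow> t \<in> g \<Longrightarrow> reval s (r l) \<ge> 0"
  using plrf[unfolded is_plrf_def, THEN conjunct2, THEN conjunct2, THEN conjunct2, THEN conjunct2,
      THEN conjunct1]
  by blast

lemma rank_non_increase:
  "g \<in> GTni \<Longrightarrow> adm_step P c (Some (gsrc g), t, s) \<Longrightarrow> agree_on (PV P) s s' \<Longrightarrow> sat s' (gguard g) \<Longrightarrow>
    exp_rank r g s' \<le> reval s' (r (gsrc g))"
  using plrf[unfolded is_plrf_def, THEN conjunct2, THEN conjunct2, THEN conjunct2, THEN conjunct2,
      THEN conjunct2, THEN conjunct1]
  by blast

lemma rank_decrease: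
  "g \<in> GTgt \<Longrightarrow> adm_step P c (Some (gsrc g), t, s) \<Longrightarrow> agree_on (PV P) s s' \<Longrightarrow> sat s' (gguard g) \<Longrightarrow>
    exp_rank r g s' \<le> reval s' (r (gsrc g)) - 1"
  using plrf[unfolded is_plrf_def, THEN conjunct2, THEN conjunct2, THEN conjunct2, THEN conjunct2,
      THEN conjunct2, THEN conjunct2]
  by blast

lemma admissible_adm_step:
  assumes "is_scheduler P \<SS>" "admissible P \<SS> s0 (cs @ [(Some l, t, s)])" "l \<noteq> init_loc P"
  shows "\<exists>c. adm_step P c (Some l, t, s)"
proof (cases cs rule: rev_cases)
  case Nil
  then show ?thesis
    using assms by (simp add: admissible_single init_conf_def)
next
  case (snoc bs c)
  then show ?thesis
    using assms(1) assms(2)[unfolded snoc append_assoc append_Cons append_Nil] unfolding adm_step_def by blast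
qed

text \<open>By \<open>no_init\<close> the path is longer than one configuration, which provides the
  predecessor that \<open>is_plrf\<close> asks for. The rank mentions program variables only, so it
  has the same value before and after the scheduler picks the temporary ones.\<close>

lemma rank_step:
  assumes \<SS>: "is_scheduler P \<SS>" and adm: "admissible P \<SS> s0 (cs @ [(Some l, t, s)])"
    and choice: "(g, s') \<in> choices P (Some l) s" and g: "g \<in> GTni"
  shows "exp_rank r g s' \<le> reval s (r l)"
    and "g \<in> GTgt \<Longrightarrow> exp_rank r g s' \<le> reval s (r l) - 1"
proof -
  have s': "agree_on (PV P) s s'" "l = gsrc g" "sat s' (gguard g)"
    using choice by (auto simp: choices_def)
  have "l \<noteq> init_loc P"
    using no_init[OF g] s'(2) by simp
  then obtain c where c: "adm_step P c (Some l, t, s)"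
    using admissible_adm_step[OF \<SS> adm] by blast
  have "l \<in> locs P"
    using gsrc_locs g GT_subsets s'(2) by blast
  then have eq: "reval s' (r l) = reval s (r l)"
    using rank_linear(1) s'(1) by (intro reval_agree_on)
  show "exp_rank r g s' \<le> reval s (r l)"
    using rank_non_increase[OF g c[unfolded s'(2)] s'(1,3)] eq s'(2) by simp
  show "exp_rank r g s' \<le> reval s (r l) - 1" if "g \<in> GTgt"
    using rank_decrease[OF that c[unfolded s'(2)] s'(1,3)] eq s'(2) by simp
qed

lemma deg_tgt: "g \<in> GT P \<Longrightarrow> \<forall>t\<in>g. deg_le (r (tgt t)) 1"
  using src_tgt_locs rank_linear(2) by blast

lemma adm_step_gstep:
  assumes "is_scheduler P \<SS>" "admissible P \<SS> s0 (cs @ [(l, t, s)])"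
    and "(g, s') \<in> choices P l s" "t \<noteq> T_bot" "(Some l', T_ex t', s'') \<in> set_pmf (gstep_pmf g s')"
  shows "adm_step P (l, t, s) (Some l', T_ex t', s'') \<and> t' \<in> g"
proof
  show "adm_step P (l, t, s) (Some l', T_ex t', s'')"
    by (rule adm_step_choice[OF pip assms])
  have "g \<in> GT P"
    using assms(3) by (simp add: choices_def)
  then show "t' \<in> g"
    using set_gstep_pmf[OF is_gtrans_GT assms(5)] by blast
qed

lemma pot_step_gt:
  assumes \<SS>: "is_scheduler P \<SS>" and adm: "admissible P \<SS> s0 (cs @ [(Some l, t, s)])"
    and choice: "(g, s') \<in> choices P (Some l) s" "t \<noteq> T_bot" and g: "g \<in> GTgt"
  shows "1 + (\<integral>\<^sup>+c. pot c \<partial>measure_pmf (gstep_pmf g s')) \<le> pot (Some l, t, s)"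
proof -
  have gs: "g \<in> GTni" "g \<in> GT P" "l = gsrc g"
    using g GT_subsets choice by (auto simp: choices_def)
  have nonneg: "0 \<le> reval s'' (r l')" if "(Some l', T_ex t', s'') \<in> set_pmf (gstep_pmf g s')" for l' t' s''
    using adm_step_gstep[OF \<SS> adm choice that] rank_nonneg[OF g] by blast
  note step = nn_integral_rank_pot_gstep_le[OF is_gtrans_GT[OF gs(2)] deg_tgt[OF gs(2)] nonneg]
  have "1 + (\<integral>\<^sup>+c. pot c \<partial>measure_pmf (gstep_pmf g s')) \<le> 1 + ennreal (exp_rank r g s')"
    by (intro add_left_mono step(2))
  \<comment> \<open>Only valid because the expected rank is nonnegative: \<open>ennreal\<close>
    would cut a negative one to 0 before 1 is added.\<close>
  also have "\<dots> = ennreal (1 + exp_rank r g s')"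
    using step(1) by (simp add: ennreal_plus)
  also have "\<dots> \<le> ennreal (reval s (r l))"
    using rank_step(2)[OF \<SS> adm choice(1) gs(1) g] by (intro ennreal_leI) simp
  also have "\<dots> = pot (Some l, t, s)"
    using gsrc_ni_locs[OF gs(1)] gs(3) by (simp add: rank_pot_def)
  finally show ?thesis .
qed

text \<open>The sign depends only on \<open>g\<close> and the configuration that is left, hence is
  common to all successors. If it is negative, all potentials after the step are 0; otherwise
  truncation has no effect and Non-Increase applies.\<close>

lemma pot_step_ni:
  assumes \<SS>: "is_scheduler P \<SS>" and adm: "admissible P \<SS> s0 (cs @ [(Some l, t, s)])"
    and choice: "(g, s') \<in> choices P (Some l) s" "t \<noteq> T_bot" and g: "g \<in> GTni - GTgt"
  shows "(\<integral>\<^sup>+c. pot c \<partial>measure_pmf (gstep_pmf g s')) \<le> pot (Some l, t, s)"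
proof -
  have gs: "g \<in> GTni" "g \<in> GT P" "l = gsrc g"
    using g GT_subsets choice by (auto simp: choices_def)
  note adm' = adm_step_gstep[OF \<SS> adm choice]
  from rank_sign[OF g, of "(Some l, t, s)"] show ?thesis
  proof
    assume neg: "\<forall>l' t' s''. adm_step P (Some l, t, s) (Some l', T_ex t', s'') \<and> t' \<in> g \<longrightarrow> reval s'' (r l') < 0"
    have "pot c = 0" if c: "c \<in> set_pmf (gstep_pmf g s')" for c
    proof -
      obtain t' s'' where c': "c = (Some (tgt t'), T_ex t', s'')" and "t' \<in> g"
        using set_gstep_pmf[OF is_gtrans_GT[OF gs(2)] c] by blast
      then have "reval s'' (r (tgt t')) < 0"
        using neg adm'[of "tgt t'" t' s''] c by blast
      then show ?thesis
        using c' by (simp add: rank_pot_def ennreal_neg)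
    qed
    then have "(\<integral>\<^sup>+c. pot c \<partial>measure_pmf (gstep_pmf g s')) = (\<integral>\<^sup>+c. 0 \<partial>measure_pmf (gstep_pmf g s'))"
      by (intro nn_integral_cong_AE) (simp add: AE_measure_pmf_iff)
    then show ?thesis
      by simp
  next
    assume nonneg: "\<forall>l' t' s''. adm_step P (Some l, t, s) (Some l', T_ex t', s'') \<and> t' \<in> g \<longrightarrow> reval s'' (r l') \<ge> 0"
    have "0 \<le> reval s'' (r l')" if "(Some l', T_ex t', s'') \<in> set_pmf (gstep_pmf g s')" for l' t' s''
      using adm'[OF that] nonneg by blast
    note step = nn_integral_rank_pot_gstep_le[OF is_gtrans_GT[OF gs(2)] deg_tgt[OF gs(2)] this]
    have "(\<integral>\<^sup>+c. pot c \<partial>measure_pmf (gstep_pmf g s')) \<le> ennreal (exp_rank r g s')"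
      by (intro step(2))
    also have "\<dots> \<le> ennreal (reval s (r l))"
      using rank_step(1)[OF \<SS> adm choice(1) gs(1)] by (intro ennreal_leI)
    also have "\<dots> = pot (Some l, t, s)"
      using gsrc_ni_locs[OF gs(1)] gs(3) by (simp add: rank_pot_def)
    finally show ?thesis .
  qed
qed

text \<open>Charged to the configuration before the entry, so that both sides of the drift
  inequality refer to the same position. Every step chosen outside of \<open>GTni\<close> is charged
  in full, even if the location it leaves is in \<open>ni_locs\<close>.\<close>

definition entry_pot :: "('l, 'v) sched \<Rightarrow> ('l, 'v) conf \<Rightarrow> ennreal" where
  "entry_pot \<SS> c = (case \<SS> c of
       (Some h, s) \<Rightarrow> if h \<in> GTni then 0 else (\<integral>\<^sup>+c. pot c \<partial>measure_pmf (gstep_pmf h s))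
     | _ \<Rightarrow> 0)"

text \<open>A step that is counted for \<open>g\<close> may stem from a general transition \<open>h\<close> outside of \<open>GTni\<close> that
  shares a transition with \<open>g\<close>. Then \<open>g\<close> is enabled as well, so the rank is at least 1, and the
  step is paid for by the rank that is given up when \<open>GTni\<close> is left.\<close>

lemma pot_drift:
  assumes \<SS>: "is_scheduler P \<SS>" and adm: "admissible P \<SS> s0 (cs @ [c])" and g: "g \<in> GTgt"
  shows "emeasure (measure_pmf (step_pmf \<SS> c)) {c'. fst (snd c') \<in> T_ex ` g} +
      (\<integral>\<^sup>+c'. pot c' \<partial>measure_pmf (step_pmf \<SS> c)) \<le> pot c + entry_pot \<SS> c"
proof -
  obtain l t s where c: "c = (l, t, s)"
    by (cases c)
  obtain a s' where a: "\<SS> c = (a, s')"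
    by (cases "\<SS> c")
  let ?count = "emeasure (measure_pmf (step_pmf \<SS> c)) {c'. fst (snd c') \<in> T_ex ` g}"
  let ?E = "\<integral>\<^sup>+c'. pot c' \<partial>measure_pmf (step_pmf \<SS> c)"
  have count_le: "?count \<le> 1"
    by (rule measure_pmf.emeasure_le_1)
  show ?thesis
  proof (cases a)
    case None
    then show ?thesis
      using a by (simp add: step_pmf_None rank_pot_def indicator_def image_iff)
  next
    case (Some h)
    have choice: "(h, s') \<in> choices P l s" "t \<noteq> T_bot"
      using is_schedulerD[OF \<SS>] admissible_confs[OF pip \<SS> adm] a c Some by auto
    then have h: "h \<in> GT P" and l: "l = Some (gsrc h)"
      by (auto simp: choices_def)
    have step: "step_pmf \<SS> c = gstep_pmf h s'"
      using a Some by (simp add: step_pmf_Some)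
    have adm': "admissible P \<SS> s0 (cs @ [(Some (gsrc h), t, s)])"
      using adm c l by simp
    have count0: "?count = 0" if "g \<inter> h = {}"
    proof -
      have "fst (snd c') \<notin> T_ex ` g" if "c' \<in> set_pmf (gstep_pmf h s')" for c'
        using set_gstep_pmf[OF is_gtrans_GT[OF h] that] \<open>g \<inter> h = {}\<close>
        by (metis (no_types) disjoint_iff fst_conv imageE label.inject snd_conv)
      then have "?count = emeasure (measure_pmf (step_pmf \<SS> c)) {}"
        by (intro emeasure_eq_AE) (auto simp: step AE_measure_pmf_iff)
      then show ?thesis
        by simp
    qed
    consider "h \<in> GTgt" | "h \<in> GTni - GTgt" | "h \<notin> GTni"
      by blast
    then show ?thesis
    proof cases
      case 1
      have "?count + ?E \<le> 1 + ?E"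
        by (intro add_right_mono count_le)
      also have "\<dots> \<le> pot c"
        unfolding step using pot_step_gt[OF \<SS> adm' choice[unfolded l] 1] by (simp add: c l)
      also have "\<dots> \<le> pot c + entry_pot \<SS> c"
        by simp
      finally show ?thesis .
    next
      case 2
      then have "?count = 0"
        using count0 disj[OF g 2] by blast
      moreover have "?E \<le> pot c"
        unfolding step using pot_step_ni[OF \<SS> adm' choice[unfolded l] 2] by (simp add: c l)
      ultimately show ?thesis
        by (simp add: add_increasing2)
    next
      case 3
      have "?count \<le> pot c"
      proof (cases "g \<inter> h = {}")
        case False
        then obtain u where u: "u \<in> g" "u \<in> h"
          by blast
        have "g \<in> GT P"
          using g GT_subsets by blast
        then have "gsrc g = gsrc h" "gguard g = gguard h"
          using gsrc_gguard_eq[of P _ u] is_gtrans_GT h u by simp_all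
        then have "(g, s') \<in> choices P (Some (gsrc h)) s"
          using choice(1) \<open>g \<in> GT P\<close> by (simp add: choices_def)
        \<comment> \<open>\<open>\<SS>\<close> chooses \<open>h\<close> here, not \<open>g\<close>.
          The estimate for \<open>g\<close> is still available because it covers every enabled
          choice, by redefining the scheduler in \<open>adm_step_choice\<close>.\<close>
        from pot_step_gt[OF \<SS> adm' this choice(2) g] have "1 \<le> pot c"
          unfolding c l by (rule order_trans[rotated]) simp
        with count_le show ?thesis
          by (rule order_trans)
      qed (simp add: count0)
      moreover have "entry_pot \<SS> c = ?E"
        using 3 a Some step by (simp add: entry_pot_def)
      ultimately show ?thesis
        by (simp add: add_right_mono)
    qed
  qed
qed

end

section \<open>Telescoping the drift along runs\<close>

context ranked_pip
begin

text \<open>Reads the entry off the label of the reached configuration, as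
  \<open>trans_count\<close>, \<open>gtrans_count\<close> and \<open>gsize\<close> do. A step of
  another general transition that shares a transition with \<open>h\<close> is therefore included,
  which only enlarges the upper bound.\<close>

definition entry_rank :: "('l, 'v) gtrans \<Rightarrow> 'l \<Rightarrow> ('l, 'v) conf \<Rightarrow> ennreal" where
  "entry_rank h l c = (if fst c = Some l \<and> fst (snd c) \<in> T_ex ` {t \<in> h. tgt t = l}
     then ennreal (reval (snd (snd c)) (r l)) else 0)"

lemma finite_entry:
  "finite (entry_trans P GTni l)" "finite (entry_locs P GTni)"
  "entry_trans P GTni l \<subseteq> GT P" "entry_locs P GTni \<subseteq> locs P"
proof -
  have fin: "finite (GT P)" "finite (locs P)"
    using pip by (simp_all add: is_pip_def)
  show sub: "entry_trans P GTni l \<subseteq> GT P" for l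
    by (auto simp: entry_trans_def)
  show "finite (entry_trans P GTni l)"
    by (rule finite_subset[OF sub fin(1)])
  have "l \<in> locs P" if l: "l \<in> entry_locs P GTni" for l
  proof -
    obtain h where h: "h \<in> entry_trans P GTni l"
      using l unfolding entry_locs_def by blast
    then obtain t where "t \<in> h" "tgt t = l"
      unfolding entry_trans_def by blast
    then show ?thesis
      using src_tgt_locs[of h t] sub h by blast
  qed
  then show loc: "entry_locs P GTni \<subseteq> locs P"
    by blast
  show "finite (entry_locs P GTni)"
    by (rule finite_subset[OF loc fin(2)])
qed

text \<open>After a step of some \<open>h\<close> outside of \<open>GTni\<close>, the potential of
  the successor is either 0 or exactly the summand for \<open>h\<close> and the reached location;
  the other summands are nonnegative.\<close>

lemma entry_pot_le:
  assumes \<SS>: "is_scheduler P \<SS>" and adm: "admissible P \<SS> s0 (cs @ [c])"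
  shows "entry_pot \<SS> c \<le> (\<Sum>l\<in>entry_locs P GTni. \<Sum>h\<in>entry_trans P GTni l.
    \<integral>\<^sup>+c'. entry_rank h l c' \<partial>measure_pmf (step_pmf \<SS> c))"
proof -
  obtain a s' where a: "\<SS> c = (a, s')"
    by (cases "\<SS> c")
  show ?thesis
  proof (cases "\<exists>h. a = Some h \<and> h \<notin> GTni")
    case False
    then show ?thesis
      using a by (auto simp: entry_pot_def split: option.split)
  next
    case True
    then obtain h where h: "a = Some h" "h \<notin> GTni"
      by blast
    obtain l0 t0 s0 where c: "c = (l0, t0, s0)"
      by (cases c)
    have "(h, s') \<in> choices P l0 s0"
      using is_schedulerD(1)[OF \<SS>] admissible_confs[OF pip \<SS> adm] a c h by auto
    then have hGT: "h \<in> GT P"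
      by (simp add: choices_def)
    let ?S = "\<lambda>c'. \<Sum>l\<in>entry_locs P GTni. \<Sum>h\<in>entry_trans P GTni l. entry_rank h l c'"
    have step: "step_pmf \<SS> c = gstep_pmf h s'"
      using a h by (simp add: step_pmf_Some)
    have "pot c' \<le> ?S c'" if c': "c' \<in> set_pmf (gstep_pmf h s')" for c'
    proof -
      obtain t s'' where eq: "c' = (Some (tgt t), T_ex t, s'')" and t: "t \<in> h"
        using set_gstep_pmf[OF is_gtrans_GT[OF hGT] c'] by blast
      show ?thesis
      proof (cases "tgt t \<in> ni_locs")
        case True
        have ent: "h \<in> entry_trans P GTni (tgt t)"
          using hGT h(2) t unfolding entry_trans_def by blast
        obtain u where "u \<in> \<Union>GTni" "src u = tgt t"
          using True unfolding ni_locs_def by (metis imageE)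
        then have loc: "tgt t \<in> entry_locs P GTni"
          using ent unfolding entry_locs_def by blast
        have "pot c' = entry_rank h (tgt t) c'"
          using True t by (simp add: eq rank_pot_def entry_rank_def)
        also have "\<dots> \<le> (\<Sum>h\<in>entry_trans P GTni (tgt t). entry_rank h (tgt t) c')"
          using ent finite_entry(1) by (intro member_le_sum) auto
        also have "\<dots> \<le> ?S c'"
          using loc finite_entry(2)
          by (intro member_le_sum[of "tgt t" _ "\<lambda>l. \<Sum>h\<in>entry_trans P GTni l. entry_rank h l c'"]) auto
        finally show ?thesis .
      qed (simp add: eq rank_pot_def)
    qed
    then have "(\<integral>\<^sup>+c'. pot c' \<partial>measure_pmf (gstep_pmf h s')) \<le> (\<integral>\<^sup>+c'. ?S c' \<partial>measure_pmf (gstep_pmf h s'))"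
      by (intro nn_integral_mono_AE) (simp add: AE_measure_pmf_iff)
    also have "\<dots> = (\<Sum>l\<in>entry_locs P GTni. \<Sum>h\<in>entry_trans P GTni l.
        \<integral>\<^sup>+c'. entry_rank h l c' \<partial>measure_pmf (step_pmf \<SS> c))"
      by (simp add: nn_integral_sum step)
    finally show ?thesis
      using a h by (simp add: entry_pot_def)
  qed
qed

text \<open>The drift inequality summed over the first \<open>n\<close> steps. The remaining
  potential \<open>E n pot\<close> stays on the left so that the induction goes through; for
  \<open>n = 0\<close> it vanishes since the initial location is not in \<open>ni_locs\<close>. The
  index \<open>Suc i\<close> appears because step \<open>i\<close> is recorded in the configuration
  that it reaches.\<close>

lemma partial_count_le:
  fixes \<SS> :: "('l, 'v) sched" and s0 :: "'v state"
  assumes \<SS>: "is_scheduler P \<SS>" and g: "g \<in> GTgt"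
  defines "E \<equiv> \<lambda>n f. \<integral>\<^sup>+cs. f (last cs) \<partial>measure_pmf (path_pmf P \<SS> s0 n)"
  shows "(\<Sum>i<n. E (Suc i) (indicator {c. fst (snd c) \<in> T_ex ` g})) + E n pot \<le>
    (\<Sum>i<n. \<Sum>l\<in>entry_locs P GTni. \<Sum>h\<in>entry_trans P GTni l. E (Suc i) (entry_rank h l))"
proof (induction n)
  case 0
  show ?case
    using init_notin_ni_locs by (simp add: E_def init_conf_def rank_pot_def)
next
  case (Suc n)
  let ?I = "indicator {c. fst (snd c) \<in> T_ex ` g} :: ('l, 'v) conf \<Rightarrow> ennreal"
  let ?L = "measure_pmf (path_pmf P \<SS> s0 n)"
  let ?A = "\<lambda>i. \<Sum>l\<in>entry_locs P GTni. \<Sum>h\<in>entry_trans P GTni l. E (Suc i) (entry_rank h l)"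
  have E_Suc: "E (Suc n) f = (\<integral>\<^sup>+cs. (\<integral>\<^sup>+c. f c \<partial>measure_pmf (step_pmf \<SS> (last cs))) \<partial>?L)" for f
    unfolding E_def by (rule nn_integral_path_pmf_Suc)
  have adm: "\<exists>bs. admissible P \<SS> s0 (bs @ [last cs])" if "cs \<in> set_pmf (path_pmf P \<SS> s0 n)" for cs
    using that set_path_pmf[of cs P \<SS> s0 n] admissible_nonempty[of P \<SS> s0 cs]
    by (metis append_butlast_last_id)
  have "E (Suc n) ?I + E (Suc n) pot =
      (\<integral>\<^sup>+cs. emeasure (measure_pmf (step_pmf \<SS> (last cs))) {c. fst (snd c) \<in> T_ex ` g} +
        (\<integral>\<^sup>+c. pot c \<partial>measure_pmf (step_pmf \<SS> (last cs))) \<partial>?L)"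
    by (simp add: E_Suc nn_integral_add)
  also have "\<dots> \<le> (\<integral>\<^sup>+cs. pot (last cs) + (\<Sum>l\<in>entry_locs P GTni. \<Sum>h\<in>entry_trans P GTni l.
      \<integral>\<^sup>+c'. entry_rank h l c' \<partial>measure_pmf (step_pmf \<SS> (last cs))) \<partial>?L)"
  proof (intro nn_integral_mono_AE, unfold AE_measure_pmf_iff, intro ballI)
    fix cs assume "cs \<in> set_pmf (path_pmf P \<SS> s0 n)"
    then obtain bs where bs: "admissible P \<SS> s0 (bs @ [last cs])"
      using adm by blast
    show "emeasure (measure_pmf (step_pmf \<SS> (last cs))) {c. fst (snd c) \<in> T_ex ` g} +
        (\<integral>\<^sup>+c. pot c \<partial>measure_pmf (step_pmf \<SS> (last cs))) \<le>
        pot (last cs) + (\<Sum>l\<in>entry_locs P GTni. \<Sum>h\<in>entry_trans P GTni l.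
          \<integral>\<^sup>+c'. entry_rank h l c' \<partial>measure_pmf (step_pmf \<SS> (last cs)))"
      by (rule order_trans[OF pot_drift[OF \<SS> bs g] add_left_mono[OF entry_pot_le[OF \<SS> bs]]])
  qed
  also have "\<dots> = E n pot + ?A n"
    unfolding E_Suc by (simp add: E_def nn_integral_add nn_integral_sum)
  finally have "E (Suc n) ?I + E (Suc n) pot \<le> E n pot + ?A n" .
  then have "(\<Sum>i<n. E (Suc i) ?I) + (E (Suc n) ?I + E (Suc n) pot) \<le>
      (\<Sum>i<n. E (Suc i) ?I) + E n pot + ?A n"
    by (simp add: add.assoc add_left_mono)
  also have "\<dots> \<le> (\<Sum>i<n. ?A i) + ?A n"
    by (intro add_right_mono Suc.IH)
  finally show ?case
    by (simp add: add.assoc)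
qed

lemma run_expectation_gtrans_count_le:
  assumes \<SS>: "is_scheduler P \<SS>" and g: "g \<in> GTgt"
  shows "run_expectation P \<SS> s0 (gtrans_count g) \<le>
    (\<Sum>l\<in>entry_locs P GTni. \<Sum>h\<in>entry_trans P GTni l.
      run_expectation P \<SS> s0 (\<lambda>\<omega>. suminf (\<lambda>i. entry_rank h l (\<omega> i))))"
proof -
  define E :: "nat \<Rightarrow> (('l, 'v) conf \<Rightarrow> ennreal) \<Rightarrow> ennreal"
    where "E = (\<lambda>n f. \<integral>\<^sup>+cs. f (last cs) \<partial>measure_pmf (path_pmf P \<SS> s0 n))"
  let ?I = "indicator {c. fst (snd c) \<in> T_ex ` g} :: ('l, 'v) conf \<Rightarrow> ennreal"
  have exp: "run_expectation P \<SS> s0 (\<lambda>\<omega>. suminf (\<lambda>i. f (\<omega> i))) = suminf (\<lambda>i. E i f)" for f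
    unfolding E_def by (rule run_expectation_suminf)
  have shift: "(\<Sum>i<n. E (Suc i) f) \<le> suminf (\<lambda>i. E i f)" for n f
  proof -
    have "(\<Sum>i<n. E (Suc i) f) \<le> (\<Sum>i<Suc n. E i f)"
      by (simp add: sum.lessThan_Suc_shift del: sum.lessThan_Suc)
    also have "\<dots> \<le> suminf (\<lambda>i. E i f)"
      by (intro sum_le_suminf) auto
    finally show ?thesis .
  qed
  have "(\<Sum>i<n. E i ?I) \<le> (\<Sum>l\<in>entry_locs P GTni. \<Sum>h\<in>entry_trans P GTni l. suminf (\<lambda>i. E i (entry_rank h l)))" for n
  proof -
    have "(\<Sum>i<n. E i ?I) \<le> (\<Sum>i<Suc n. E i ?I)"
      by simp
    \<comment> \<open>Position 0 carries the label \<open>T_in\<close> and is never counted.\<close>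
    also have "\<dots> = (\<Sum>i<n. E (Suc i) ?I)"
      unfolding sum.lessThan_Suc_shift by (simp add: E_def init_conf_def image_iff)
    also have "\<dots> \<le> (\<Sum>i<n. E (Suc i) ?I) + E n pot"
      by simp
    also have "\<dots> \<le> (\<Sum>i<n. \<Sum>l\<in>entry_locs P GTni. \<Sum>h\<in>entry_trans P GTni l. E (Suc i) (entry_rank h l))"
      unfolding E_def by (rule partial_count_le[OF \<SS> g])
    also have "\<dots> = (\<Sum>l\<in>entry_locs P GTni. \<Sum>i<n. \<Sum>h\<in>entry_trans P GTni l. E (Suc i) (entry_rank h l))"
      by (rule sum.swap)
    also have "\<dots> = (\<Sum>l\<in>entry_locs P GTni. \<Sum>h\<in>entry_trans P GTni l. \<Sum>i<n. E (Suc i) (entry_rank h l))"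
      by (intro sum.cong refl sum.swap)
    also have "\<dots> \<le> (\<Sum>l\<in>entry_locs P GTni. \<Sum>h\<in>entry_trans P GTni l. suminf (\<lambda>i. E i (entry_rank h l)))"
      by (intro sum_mono shift)
    finally show ?thesis .
  qed
  then have "suminf (\<lambda>i. E i ?I) \<le>
      (\<Sum>l\<in>entry_locs P GTni. \<Sum>h\<in>entry_trans P GTni l. suminf (\<lambda>i. E i (entry_rank h l)))"
    unfolding suminf_eq_SUP by (intro SUP_least)
  then show ?thesis
    unfolding exp gtrans_count_eq[abs_def] .
qed

end

section \<open>Bounding the rank at the entries\<close>

lemma mono_eval_ennreal_mono:
  fixes \<beta> \<beta>' :: "'v \<Rightarrow> ennreal"
  assumes "\<And>x. x \<in> Poly_Mapping.keys m \<Longrightarrow> \<beta> x \<le> \<beta>' x"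
  shows "mono_eval \<beta> m \<le> mono_eval \<beta>' m"
  unfolding mono_eval_def using assms by (intro prod_mono_ennreal power_mono_ennreal)

lemma ennreal_abs_mono_eval:
  "ennreal \<bar>mono_eval (\<lambda>x. real_of_int (s x)) m\<bar> = mono_eval (\<lambda>x. of_nat (abs_state s x)) m"
proof -
  have "ennreal (\<bar>real_of_int i\<bar> ^ k) = of_nat (nat \<bar>i\<bar>) ^ k" for i k
    by (simp add: ennreal_of_nat_eq_real_of_nat flip: ennreal_power)
  then show ?thesis
    by (simp add: mono_eval_def abs_prod power_abs abs_state_def flip: prod_ennreal)
qed

text \<open>Triangle inequality over the monomials. The constant functions
  \<open>\<lambda>x _. \<beta> x\<close> allow run-dependent sizes to be substituted by
  \<open>abs_poly_subst\<close>, which expects bounds.\<close>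

lemma ennreal_reval_le:
  assumes "\<And>x. x \<in> pvarset p \<Longrightarrow> of_nat (abs_state s x) \<le> \<beta> x"
  shows "ennreal (reval s p) \<le> abs_poly_subst (\<lambda>x _. \<beta> x) p \<sigma>"
proof -
  let ?c = "Poly_Mapping.lookup p" and ?e = "mono_eval (\<lambda>x. real_of_int (s x))"
  have "ennreal (reval s p) \<le> ennreal (\<Sum>m\<in>Poly_Mapping.keys p. \<bar>?c m\<bar> * \<bar>?e m\<bar>)"
    unfolding reval_def peval_def
    by (intro ennreal_leI sum_mono) (simp flip: abs_mult)
  also have "\<dots> = (\<Sum>m\<in>Poly_Mapping.keys p. ennreal \<bar>?c m\<bar> * ennreal \<bar>?e m\<bar>)"
    by (simp add: sum_ennreal ennreal_mult flip: sum_ennreal)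
  also have "\<dots> \<le> (\<Sum>m\<in>Poly_Mapping.keys p. ennreal \<bar>?c m\<bar> * mono_eval \<beta> m)"
    unfolding ennreal_abs_mono_eval using assms
    by (intro sum_mono mult_left_mono mono_eval_ennreal_mono) (auto simp: pvarset_def)
  finally show ?thesis
    by (simp add: abs_poly_subst_def)
qed

text \<open>A supremum over a fixed countable index set, as measurability requires. The default 0 is
  harmless because it is the least element of \<open>ennreal\<close>, and so also the supremum when
  no position qualifies.\<close>

lemma gsize_eq:
  "gsize g l x \<omega> = (SUP i. if fst (\<omega> i) = Some l \<and> fst (snd (\<omega> i)) \<in> T_ex ` g
     then of_nat (abs_state (snd (snd (\<omega> i))) x) else 0)"
  unfolding gsize_def
proof (rule antisym)
  let ?f = "\<lambda>i. if fst (\<omega> i) = Some l \<and> fst (snd (\<omega> i)) \<in> T_ex ` g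
     then of_nat (abs_state (snd (snd (\<omega> i))) x) else 0 :: ennreal"
  let ?I = "{i. fst (\<omega> i) = Some l \<and> fst (snd (\<omega> i)) \<in> T_ex ` g}"
  show "(SUP i\<in>?I. of_nat (abs_state (snd (snd (\<omega> i))) x)) \<le> (SUP i. ?f i)"
    by (rule SUP_mono) auto
  show "(SUP i. ?f i) \<le> (SUP i\<in>?I. of_nat (abs_state (snd (snd (\<omega> i))) x))"
    by (rule SUP_least) (auto intro: SUP_upper)
qed

lemma measurable_gsize [measurable]: "gsize g l x \<in> borel_measurable (run_measure P \<SS> s0)"
proof -
  define f :: "('a, 'b) conf \<Rightarrow> ennreal" where
    "f c = (if fst c = Some l \<and> fst (snd c) \<in> T_ex ` g then of_nat (abs_state (snd (snd c)) x) else 0)" for c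
  have "f \<in> borel_measurable (count_space UNIV)"
    by simp
  then have "(\<lambda>\<omega>. SUP i. f (\<omega> i)) \<in> borel_measurable (run_measure P \<SS> s0)"
    by (intro borel_measurable_SUP measurable_run_component countableI_type)
  moreover have "gsize g l x = (\<lambda>\<omega>. SUP i. f (\<omega> i))"
    unfolding f_def by (rule ext) (rule gsize_eq)
  ultimately show ?thesis
    by simp
qed

text \<open>Only for polynomials of degree at most 1: the expectation of a product of sizes is not bounded
  by the product of their expectations.\<close>

lemma nn_integral_abs_poly_subst_gsize:
  assumes deg: "deg_le p 1" and vars: "pvarset p \<subseteq> X"
    and size: "\<And>x. x \<in> X \<Longrightarrow> (\<integral>\<^sup>+\<omega>. gsize h l x \<omega> \<partial>run_measure P \<SS> s0) \<le> \<beta> x \<sigma>"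
  shows "(\<integral>\<^sup>+\<omega>. abs_poly_subst (\<lambda>x _. gsize h l x \<omega>) p \<sigma> \<partial>run_measure P \<SS> s0) \<le> abs_poly_subst \<beta> p \<sigma>"
proof -
  let ?M = "run_measure P \<SS> s0"
  interpret prob_space ?M
    by (rule prob_space_run_measure)
  have meas: "(\<lambda>\<omega>. mono_eval (\<lambda>x. gsize h l x \<omega>) m) \<in> borel_measurable ?M" for m
    unfolding mono_eval_def by measurable
  have mono: "(\<integral>\<^sup>+\<omega>. mono_eval (\<lambda>x. gsize h l x \<omega>) m \<partial>?M) \<le> mono_eval (\<lambda>x. \<beta> x \<sigma>) m"
    if m: "m \<in> Poly_Mapping.keys p" for m
  proof -
    have "mono_degree m \<le> 1"
      using deg m by (simp add: deg_le_def)
    then show ?thesis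
    proof (cases rule: mono_degree_le_1_cases)
      case one
      then show ?thesis
        by (simp add: mono_eval_def emeasure_space_1[simplified])
    next
      case (var x)
      then have "x \<in> X"
        using vars m unfolding pvarset_def by blast
      then show ?thesis
        using var size by (simp add: mono_eval_def)
    qed
  qed
  have "(\<integral>\<^sup>+\<omega>. abs_poly_subst (\<lambda>x _. gsize h l x \<omega>) p \<sigma> \<partial>?M) =
      (\<Sum>m\<in>Poly_Mapping.keys p. ennreal \<bar>Poly_Mapping.lookup p m\<bar> *
        (\<integral>\<^sup>+\<omega>. mono_eval (\<lambda>x. gsize h l x \<omega>) m \<partial>?M))"
    unfolding abs_poly_subst_def using meas by (simp add: nn_integral_sum nn_integral_cmult)
  also have "\<dots> \<le> abs_poly_subst \<beta> p \<sigma>"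
    unfolding abs_poly_subst_def by (intro sum_mono mult_left_mono mono) auto
  finally show ?thesis .
qed

text \<open>\<open>RT\<close> bounds counts on finite admissible paths; almost surely all nonempty
  prefixes of a run are such paths, and the count on the run is the supremum of the counts on
  them.\<close>

lemma AE_trans_count_le:
  assumes RT: "runtime_bound P RT" and \<SS>: "is_scheduler P \<SS>" and t: "t \<in> transitions P"
  shows "AE \<omega> in run_measure P \<SS> s0.
    suminf (\<lambda>i. indicator {c. fst (snd c) = T_ex t} (\<omega> i)) \<le> RT t (abs_state s0)"
  using AE_run_prefix[of P \<SS> s0]
proof eventually_elim
  case (elim \<omega>)
  let ?I = "\<lambda>i. indicator {c. fst (snd c) = T_ex t} (\<omega> i) :: ennreal"
  have count: "(\<Sum>i<n. ?I i) = of_nat (trans_count t (map \<omega> [0..<n]))" for n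
  proof -
    have "(\<Sum>i<n. ?I i) = (\<Sum>i<n. of_bool (fst (snd (\<omega> i)) = T_ex t))"
      by (intro sum.cong) (auto simp: indicator_def)
    also have "\<dots> = of_nat (card ({..<n} \<inter> {i. fst (snd (\<omega> i)) = T_ex t}))"
      by simp
    also have "{..<n} \<inter> {i. fst (snd (\<omega> i)) = T_ex t} =
        {i. i < length (map \<omega> [0..<n]) \<and> fst (snd (map \<omega> [0..<n] ! i)) = T_ex t}"
      by auto
    finally show ?thesis
      by (simp only: trans_count_def)
  qed
  have "(\<Sum>i<n. ?I i) \<le> RT t (abs_state s0)" for n
  proof -
    let ?cs = "map \<omega> [0..<Suc n]"
    \<comment> \<open>One more position is taken because the empty prefix, for \<open>n = 0\<close>,
      is not an admissible path.\<close>
    have "(\<Sum>i<n. ?I i) \<le> (\<Sum>i<Suc n. ?I i)"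
      by simp
    also have "\<dots> = of_nat (trans_count t ?cs)"
      by (rule count)
    also have "\<dots> \<le> (SUP cs\<in>{cs. \<exists>\<SS>. is_scheduler P \<SS> \<and> admissible P \<SS> s0 cs}. of_nat (trans_count t cs))"
      using elim \<SS> by (intro SUP_upper) blast
    also have "\<dots> \<le> RT t (abs_state s0)"
      using RT t unfolding runtime_bound_def by blast
    finally show ?thesis .
  qed
  then show "suminf ?I \<le> RT t (abs_state s0)"
    unfolding suminf_eq_SUP by (intro SUP_least)
qed

lemma abs_poly_subst_single: "abs_poly_subst \<beta> (Poly_Mapping.single 0 a) \<sigma> = ennreal \<bar>a\<bar>"
  by (cases "a = 0") (simp_all add: abs_poly_subst_def mono_eval_def)

lemma reval_single: "reval s (Poly_Mapping.single 0 a) = a"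
  by (cases "a = 0") (simp_all add: reval_def peval_def mono_eval_def)

lemma is_const_polyE:
  assumes "is_const_poly p"
  obtains a where "p = Poly_Mapping.single 0 a"
  using assms by (auto simp: is_const_poly_def)

context ranked_pip
begin

text \<open>Each entry contributes at most the absolute value of the constant, and each is counted
  by \<open>gtrans_count h\<close>; the constant factors out of the expectation of that
  count.\<close>

lemma entry_const_le:
  assumes RTE: "expected_runtime_bound P RTE" and \<SS>: "is_scheduler P \<SS>"
    and h: "h \<in> GT P" and const: "is_const_poly (r l)"
  shows "run_expectation P \<SS> s0 (\<lambda>\<omega>. suminf (\<lambda>i. entry_rank h l (\<omega> i))) \<le>
    RTE h (abs_state s0) * abs_poly_subst bvar (r l) (abs_state s0)"
proof -
  obtain a where a: "r l = Poly_Mapping.single 0 a"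
    using const by (rule is_const_polyE)
  have count: "run_expectation P \<SS> s0 (gtrans_count h) \<le> RTE h (abs_state s0)"
    using RTE \<SS> h unfolding expected_runtime_bound_def by blast
  have "entry_rank h l c \<le> ennreal \<bar>a\<bar> * indicator {c. fst (snd c) \<in> T_ex ` h} c" for c
    by (auto simp: entry_rank_def a reval_single intro: ennreal_leI)
  then have "suminf (\<lambda>i. entry_rank h l (\<omega> i)) \<le> suminf (\<lambda>i. ennreal \<bar>a\<bar> * indicator {c. fst (snd c) \<in> T_ex ` h} (\<omega> i))" for \<omega>
    by (intro suminf_le) auto
  then have le: "suminf (\<lambda>i. entry_rank h l (\<omega> i)) \<le> ennreal \<bar>a\<bar> * gtrans_count h \<omega>" for \<omega>
    unfolding gtrans_count_eq by simp
  have meas: "gtrans_count h \<in> borel_measurable (run_measure P \<SS> s0)"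
    unfolding gtrans_count_eq[abs_def]
    by (intro borel_measurable_suminf_order measurable_run_component) simp
  have "run_expectation P \<SS> s0 (\<lambda>\<omega>. suminf (\<lambda>i. entry_rank h l (\<omega> i))) \<le>
      (\<integral>\<^sup>+\<omega>. ennreal \<bar>a\<bar> * gtrans_count h \<omega> \<partial>run_measure P \<SS> s0)"
    unfolding run_expectation_def by (intro nn_integral_mono le)
  also have "\<dots> = ennreal \<bar>a\<bar> * run_expectation P \<SS> s0 (gtrans_count h)"
    unfolding run_expectation_def using meas by (rule nn_integral_cmult)
  also have "\<dots> \<le> ennreal \<bar>a\<bar> * RTE h (abs_state s0)"
    by (intro mult_left_mono count) simp
  finally show ?thesis
    by (simp add: a abs_poly_subst_single mult.commute)
qed

text \<open>On almost every run, the total rank at the entries is at most a deterministic number of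
  entries times a random value that dominates each single rank; only the latter has to be
  integrated.\<close>

lemma entry_nonconst_le:
  assumes RT: "runtime_bound P RT" and SE: "expected_size_bound P SE" and \<SS>: "is_scheduler P \<SS>"
    and h: "h \<in> entry_trans P GTni l"
  shows "run_expectation P \<SS> s0 (\<lambda>\<omega>. suminf (\<lambda>i. entry_rank h l (\<omega> i))) \<le>
    (\<Sum>t\<in>{t \<in> h. tgt t = l}. RT t (abs_state s0)) * abs_poly_subst (SE h l) (r l) (abs_state s0)"
proof -
  let ?M = "run_measure P \<SS> s0" and ?\<sigma> = "abs_state s0" and ?H = "{t \<in> h. tgt t = l}"
  \<comment> \<open>With each variable replaced by its supremum over the run,
    \<open>Z \<omega>\<close> no longer depends on the position and can be pulled out of the sum
    over all positions.\<close>
  define Z where "Z \<omega> = abs_poly_subst (\<lambda>x _. gsize h l x \<omega>) (r l) ?\<sigma>" for \<omega>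
  have hGT: "h \<in> GT P" and "\<exists>t\<in>h. tgt t = l"
    using h by (auto simp: entry_trans_def)
  then have l: "l \<in> tgt ` h" "l \<in> locs P"
    using src_tgt_locs by blast+
  have fin: "finite ?H"
    using is_gtrans_GT[OF hGT] by (simp add: is_gtrans_def)
  have H: "t \<in> transitions P" if "t \<in> ?H" for t
    using that hGT by (auto simp: transitions_def)
  have entry_le: "entry_rank h l (\<omega> i) \<le> (\<Sum>t\<in>?H. indicator {c. fst (snd c) = T_ex t} (\<omega> i)) * Z \<omega>" for \<omega> i
  proof (cases "fst (\<omega> i) = Some l \<and> fst (snd (\<omega> i)) \<in> T_ex ` ?H")
    case True
    then obtain t where t: "t \<in> ?H" "fst (snd (\<omega> i)) = T_ex t"
      by blast
    have "ennreal (reval (snd (snd (\<omega> i))) (r l)) \<le> Z \<omega>"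
      unfolding Z_def gsize_def using True by (intro ennreal_reval_le SUP_upper) auto
    moreover have "indicator {c. fst (snd c) = T_ex t} (\<omega> i) \<le>
        (\<Sum>t\<in>?H. indicator {c. fst (snd c) = T_ex t} (\<omega> i) :: ennreal)"
      using t(1) fin by (intro member_le_sum) auto
    ultimately have "1 * ennreal (reval (snd (snd (\<omega> i))) (r l)) \<le>
        (\<Sum>t\<in>?H. indicator {c. fst (snd c) = T_ex t} (\<omega> i)) * Z \<omega>"
      using t(2) by (intro mult_mono) simp_all
    then show ?thesis
      using True by (simp add: entry_rank_def)
  next
    case False
    then have "entry_rank h l (\<omega> i) = 0"
      unfolding entry_rank_def by (rule if_not_P)
    then show ?thesis
      by simp
  qed
  have AE_le: "AE \<omega> in ?M. suminf (\<lambda>i. entry_rank h l (\<omega> i)) \<le> (\<Sum>t\<in>?H. RT t ?\<sigma>) * Z \<omega>"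
  proof -
    have "AE \<omega> in ?M. \<forall>t\<in>?H. suminf (\<lambda>i. indicator {c. fst (snd c) = T_ex t} (\<omega> i)) \<le> RT t ?\<sigma>"
      using AE_trans_count_le[OF RT \<SS> H] by (intro AE_finite_allI[OF fin])
    then show ?thesis
    proof eventually_elim
      case (elim \<omega>)
      have "suminf (\<lambda>i. entry_rank h l (\<omega> i)) \<le>
          suminf (\<lambda>i. (\<Sum>t\<in>?H. indicator {c. fst (snd c) = T_ex t} (\<omega> i)) * Z \<omega>)"
        by (intro suminf_le entry_le) auto
      also have "\<dots> = suminf (\<lambda>i. \<Sum>t\<in>?H. indicator {c. fst (snd c) = T_ex t} (\<omega> i)) * Z \<omega>"
        by (rule ennreal_suminf_multc)
      also have "suminf (\<lambda>i. \<Sum>t\<in>?H. indicator {c. fst (snd c) = T_ex t} (\<omega> i) :: ennreal) =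
          (\<Sum>t\<in>?H. suminf (\<lambda>i. indicator {c. fst (snd c) = T_ex t} (\<omega> i)))"
        by (rule suminf_sum) simp
      also have "\<dots> * Z \<omega> \<le> (\<Sum>t\<in>?H. RT t ?\<sigma>) * Z \<omega>"
        using elim by (intro mult_right_mono sum_mono) auto
      finally show ?case .
    qed
  qed
  have size: "(\<integral>\<^sup>+\<omega>. gsize h l x \<omega> \<partial>?M) \<le> SE h l x ?\<sigma>" if "x \<in> PV P" for x
  proof -
    have "(h, l, x) \<in> grv P"
      using hGT l(1) that by (simp add: grv_def)
    then have "run_expectation P \<SS> s0 (gsize h l x) \<le> SE h l x ?\<sigma>"
      using SE \<SS> unfolding expected_size_bound_def by fast
    then show ?thesis
      by (simp add: run_expectation_def)
  qed
  have meas: "Z \<in> borel_measurable ?M"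
    unfolding Z_def[abs_def] abs_poly_subst_def mono_eval_def by measurable
  have "run_expectation P \<SS> s0 (\<lambda>\<omega>. suminf (\<lambda>i. entry_rank h l (\<omega> i))) \<le>
      (\<integral>\<^sup>+\<omega>. (\<Sum>t\<in>?H. RT t ?\<sigma>) * Z \<omega> \<partial>?M)"
    unfolding run_expectation_def using AE_le by (rule nn_integral_mono_AE)
  also have "\<dots> = (\<Sum>t\<in>?H. RT t ?\<sigma>) * (\<integral>\<^sup>+\<omega>. Z \<omega> \<partial>?M)"
    using meas by (rule nn_integral_cmult)
  also have "\<dots> \<le> (\<Sum>t\<in>?H. RT t ?\<sigma>) * abs_poly_subst (SE h l) (r l) ?\<sigma>"
    unfolding Z_def using rank_linear[OF l(2)] size
    by (intro mult_left_mono nn_integral_abs_poly_subst_gsize) auto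
  finally show ?thesis .
qed

end

section \<open>The refined bound is a bound\<close>

lemma bounds_sum:
  "finite A \<Longrightarrow> (\<And>a. a \<in> A \<Longrightarrow> b a \<in> bounds X) \<Longrightarrow> (\<lambda>\<sigma>. \<Sum>a\<in>A. b a \<sigma>) \<in> bounds X"
  by (induction A rule: finite_induct) (auto intro: bounds_const bounds_add)

lemma bounds_prod:
  "finite A \<Longrightarrow> (\<And>a. a \<in> A \<Longrightarrow> b a \<in> bounds X) \<Longrightarrow> (\<lambda>\<sigma>. \<Prod>a\<in>A. b a \<sigma>) \<in> bounds X"
  by (induction A rule: finite_induct) (auto intro: bounds_const bounds_mult)

lemma bounds_power: "b \<in> bounds X \<Longrightarrow> (\<lambda>\<sigma>. b \<sigma> ^ n) \<in> bounds X"
  by (induction n) (auto intro: bounds_const bounds_mult)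

lemma bounds_abs_poly_subst:
  assumes "\<And>x. x \<in> pvarset p \<Longrightarrow> \<beta> x \<in> bounds X"
  shows "abs_poly_subst \<beta> p \<in> bounds X"
  unfolding abs_poly_subst_def mono_eval_def using assms
  by (intro bounds_sum bounds_mult bounds_const bounds_prod bounds_power) (auto simp: pvarset_def)

theorem mainTheorem6:
  fixes P :: "('l, 'v::finite) pip"
    and RTE :: "('l, 'v) gtrans \<Rightarrow> 'v bound"
    and SE :: "('l, 'v) gtrans \<Rightarrow> 'l \<Rightarrow> 'v \<Rightarrow> 'v bound"
    and RT :: "('l, 'v) trans \<Rightarrow> 'v bound"
    and r :: "'l \<Rightarrow> ('v, real) mpoly"
    and GTgt GTni :: "('l, 'v) gtrans set"
  assumes "is_pip P"
    and "expected_bound_pair P RTE SE"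
    and "runtime_bound P RT"
    and "is_plrf P r GTgt GTni"
    and "\<And>g. g \<in> GTni \<Longrightarrow> gsrc g \<noteq> init_loc P"
    and "\<And>g h. g \<in> GTgt \<Longrightarrow> h \<in> GTni - GTgt \<Longrightarrow> g \<inter> h = {}"
  shows "expected_runtime_bound P (refined_runtime_bound P RTE SE RT r GTgt GTni)"
proof -
  interpret ranked_pip P r GTgt GTni
    using assms(1,4,5,6) by (rule ranked_pip.intro)
  have RTE: "expected_runtime_bound P RTE" and SE: "expected_size_bound P SE"
    using assms(2) by (simp_all add: expected_bound_pair_def)
  let ?R = "refined_runtime_bound P RTE SE RT r GTgt GTni"
  let ?nc = "nonconst_entry_locs P r GTni" and ?c = "const_entry_locs P r GTni"
  have sub: "?nc \<subseteq> entry_locs P GTni" "?c \<subseteq> entry_locs P GTni"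
    by (auto simp: nonconst_entry_locs_def const_entry_locs_def)
  note fin = finite_subset[OF sub(1) finite_entry(2)] finite_subset[OF sub(2) finite_entry(2)]
  have hGT: "h \<in> GT P" if "h \<in> entry_trans P GTni l" for h l
    using that finite_entry(3) by blast
  have "?R g \<in> bounds (PV P)" if g: "g \<in> GT P" for g
  proof (cases "g \<in> GTgt")
    case False
    then show ?thesis
      using RTE g by (simp add: refined_runtime_bound_def expected_runtime_bound_def)
  next
    case True
    have RTE_b: "RTE h \<in> bounds (PV P)" if "h \<in> entry_trans P GTni l" for h l
      using RTE hGT[OF that] unfolding expected_runtime_bound_def by blast
    have RT_b: "(\<lambda>\<sigma>. \<Sum>t\<in>{t \<in> h. tgt t = l}. RT t \<sigma>) \<in> bounds (PV P)"
      if "h \<in> entry_trans P GTni l" for h l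
    proof (rule bounds_sum)
      show "finite {t \<in> h. tgt t = l}"
        using is_gtrans_GT[OF hGT[OF that]] by (simp add: is_gtrans_def)
      show "RT t \<in> bounds (PV P)" if "t \<in> {t \<in> h. tgt t = l}" for t
        using assms(3) that hGT[OF \<open>h \<in> entry_trans P GTni l\<close>]
        unfolding runtime_bound_def transitions_def by blast
    qed
    have vars: "pvarset (r l) \<subseteq> PV P" if "l \<in> entry_locs P GTni" for l
      using rank_linear(1) finite_entry(4) that by blast
    have SE_b: "abs_poly_subst (SE h l) (r l) \<in> bounds (PV P)"
      if "l \<in> entry_locs P GTni" "h \<in> entry_trans P GTni l" for h l
    proof (rule bounds_abs_poly_subst)
      \<comment> \<open>\<open>SE\<close> is known to yield bounds on \<open>grv P\<close> only;
        this needs \<open>x\<close> to be a program variable, which holds for the variables of the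
        rank, and \<open>l\<close> to be a target of \<open>h\<close>.\<close>
      fix x assume "x \<in> pvarset (r l)"
      then have "(h, l, x) \<in> grv P"
        using vars[OF that(1)] hGT[OF that(2)] that(2) by (auto simp: grv_def entry_trans_def)
      then show "SE h l x \<in> bounds (PV P)"
        using SE unfolding expected_size_bound_def by fast
    qed
    have var_b: "abs_poly_subst bvar (r l) \<in> bounds (PV P)" if "l \<in> entry_locs P GTni" for l
      using vars[OF that] by (intro bounds_abs_poly_subst bounds_var) blast
    have "(\<lambda>\<sigma>. (\<Sum>l\<in>?nc. \<Sum>h\<in>entry_trans P GTni l.
          (\<Sum>t\<in>{t \<in> h. tgt t = l}. RT t \<sigma>) * abs_poly_subst (SE h l) (r l) \<sigma>) +
        (\<Sum>l\<in>?c. \<Sum>h\<in>entry_trans P GTni l. RTE h \<sigma> * abs_poly_subst bvar (r l) \<sigma>))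
        \<in> bounds (PV P)"
      using sub by (intro bounds_add bounds_sum fin finite_entry(1) bounds_mult RT_b RTE_b SE_b var_b) blast+
    then show ?thesis
      using True by (simp add: refined_runtime_bound_def)
  qed
  moreover have "run_expectation P \<SS> s0 (gtrans_count g) \<le> ?R g (abs_state s0)"
    if g: "g \<in> GT P" and \<SS>: "is_scheduler P \<SS>" for g \<SS> s0
  proof (cases "g \<in> GTgt")
    case False
    then show ?thesis
      using RTE g \<SS> by (simp add: refined_runtime_bound_def expected_runtime_bound_def)
  next
    case True
    let ?X = "\<lambda>h l. run_expectation P \<SS> s0 (\<lambda>\<omega>. suminf (\<lambda>i. entry_rank h l (\<omega> i)))"
    have "entry_locs P GTni = ?nc \<union> ?c" "?nc \<inter> ?c = {}"
      by (auto simp: nonconst_entry_locs_def const_entry_locs_def)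
    then have "(\<Sum>l\<in>entry_locs P GTni. \<Sum>h\<in>entry_trans P GTni l. ?X h l) =
        (\<Sum>l\<in>?nc. \<Sum>h\<in>entry_trans P GTni l. ?X h l) + (\<Sum>l\<in>?c. \<Sum>h\<in>entry_trans P GTni l. ?X h l)"
      using fin by (simp add: sum.union_disjoint)
    also have "\<dots> \<le> ?R g (abs_state s0)"
    proof -
      have "is_const_poly (r l)" if "l \<in> ?c" for l
        using that by (simp add: const_entry_locs_def)
      then show ?thesis
        using True by (simp add: refined_runtime_bound_def)
          (intro add_mono sum_mono entry_nonconst_le[OF assms(3) SE \<SS>] entry_const_le[OF RTE \<SS>] hGT; assumption?)
    qed
    finally show ?thesis
      using run_expectation_gtrans_count_le[OF \<SS> True] by (rule order_trans[rotated])
  qed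
  ultimately show ?thesis
    unfolding expected_runtime_bound_def by blast
qed

end
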